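(* Let $V$ be a smooth (paracompact) manifold, $f:V\to\mathbb R$ a smooth function and $c\in V$ a non-degenerate critical point of $f$. Put $E=T_cV$, and let $q=q_c:E\to\mathbb R$ be the Hessian quadratic form of $f$ at $c$ and $b$ its associated bilinear form. Let $N\subset E$ be a maximal subspace on which $q$ is negative definite and put $P=N^{\perp_b}$ (respectively, let $P\subset E$ be a maximal subspace on which $q$ is positive definite and put $N=P^{\perp_b}$), where $\perp_b$ denotes the $b$-orthogonal. Then $0$ has star-shaped neighbourhoods $U_N$, $U_P$, $U=U_N+U_P$ in $N$, $P$, $E=N\oplus P$ respectively, and there is a diffeomorphism $\psi:(U,0)\to(\mathcal U,c)$ onto a neighbourhood $\mathcal U$ of $c$ in $V$ such that $$T_0\psi=\mathrm{Id}_{T_cV}\qquad\text{and}\qquad f\circ\psi-f(c)=q|_U=(q|_N\oplus q|_P)|_U .$$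
   Context: At a critical point $c$ of $f$, the Hessian quadratic form is $q_c(X)=\frac12X(X(f))(c)$ for germs of vector fields $X$ at $c$; it depends only on $X_c\in T_cV$. Its associated symmetric bilinear form is $b(X,X')=q_c(X+X')-q_c(X)-q_c(X')=X(X'(f))(c)$ (the second derivative). The critical point $c$ is non-degenerate if $b$ induces an isomorphism $T_cV\to T_c^*V$. *)

theory Defs
  imports "HOL-Analysis.Analysis" "HOL-Library.Function_Algebras"
begin

section \<open>Pointwise real vector space structure on functions\<close>

text \<open>Tangent vectors are real-valued functionals on functions; this makes them elements
  of a real vector space type, in which each tangent space is a subspace.\<close>

instantiation "fun" :: (type, real_vector) real_vector
begin

definition scaleR_fun :: "real \<Rightarrow> ('a \<Rightarrow> 'b) \<Rightarrow> 'a \<Rightarrow> 'b" where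
  "scaleR_fun r f = (\<lambda>x. r *\<^sub>R f x)"

instance
  by standard (simp_all add: scaleR_fun_def fun_eq_iff scaleR_add_right scaleR_add_left)

end

section \<open>Smooth maps between open subsets of Euclidean spaces\<close>

text \<open>Intended for open sets \<open>S\<close>; between finite-dimensional spaces the
  directional derivatives carry the same information as the full derivative.\<close>

primrec Ck_on :: "nat \<Rightarrow> 'a set \<Rightarrow> ('a::real_normed_vector \<Rightarrow> 'b::real_normed_vector) \<Rightarrow> bool" where
  "Ck_on 0 S f \<longleftrightarrow> continuous_on S f"
| "Ck_on (Suc k) S f \<longleftrightarrow> (\<forall>x\<in>S. f differentiable (at x)) \<and>
     (\<forall>v. Ck_on k S (\<lambda>x. frechet_derivative f (at x) v))"

definition smooth_on :: "'a set \<Rightarrow> ('a::real_normed_vector \<Rightarrow> 'b::real_normed_vector) \<Rightarrow> bool" where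
  "smooth_on S f \<longleftrightarrow> (\<forall>k. Ck_on k S f)"

section \<open>Smooth manifolds\<close>

text \<open>A chart is a pair of an open domain \<open>U\<close> and a map that is relevant on \<open>U\<close> only.
  Atlases are not required to be maximal.\<close>

type_synonym ('a, 'e) atlas = "('a set \<times> ('a \<Rightarrow> 'e)) set"

definition chart :: "'a topology \<Rightarrow> 'a set \<Rightarrow> ('a \<Rightarrow> 'e::euclidean_space) \<Rightarrow> bool" where
  "chart V U \<phi> \<longleftrightarrow> openin V U \<and> open (\<phi> ` U) \<and>
     homeomorphic_map (subtopology V U) (top_of_set (\<phi> ` U)) \<phi>"

definition smooth_atlas :: "'a topology \<Rightarrow> ('a, 'e::euclidean_space) atlas \<Rightarrow> bool" where
  "smooth_atlas V A \<longleftrightarrow>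
     (\<forall>(U, \<phi>)\<in>A. chart V U \<phi>) \<and> (\<Union>(U, \<phi>)\<in>A. U) = topspace V \<and>
     (\<forall>(U, \<phi>)\<in>A. \<forall>(U', \<phi>')\<in>A. smooth_on (\<phi> ` (U \<inter> U')) (\<phi>' \<circ> inv_into U \<phi>))"

definition paracompact_space :: "'a topology \<Rightarrow> bool" where
  "paracompact_space V \<longleftrightarrow>
     (\<forall>\<C>. (\<forall>C\<in>\<C>. openin V C) \<and> \<Union>\<C> = topspace V \<longrightarrow>
       (\<exists>\<D>. (\<forall>D\<in>\<D>. openin V D \<and> (\<exists>C\<in>\<C>. D \<subseteq> C)) \<and> \<Union>\<D> = topspace V \<and>
            locally_finite_in V \<D>))"

definition smooth_manifold :: "'a topology \<Rightarrow> ('a, 'e::euclidean_space) atlas \<Rightarrow> bool" where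
  "smooth_manifold V A \<longleftrightarrow> Hausdorff_space V \<and> paracompact_space V \<and> smooth_atlas V A"

text \<open>Smoothness on \<open>S\<close> (an open subset of \<open>V\<close>) of a map into the manifold with atlas \<open>B\<close>:
  around each point, the expression of the map in some pair of charts is smooth.\<close>

definition smooth_map_on ::
  "'a topology \<Rightarrow> ('a, 'e::euclidean_space) atlas \<Rightarrow> ('b, 'f::euclidean_space) atlas \<Rightarrow>
   'a set \<Rightarrow> ('a \<Rightarrow> 'b) \<Rightarrow> bool" where
  "smooth_map_on V A B S F \<longleftrightarrow>
     (\<forall>x\<in>S. \<exists>U \<phi> U' \<phi>' T. (U, \<phi>) \<in> A \<and> (U', \<phi>') \<in> B \<and>
        openin V T \<and> x \<in> T \<and> T \<subseteq> S \<inter> U \<and> F ` T \<subseteq> U' \<and>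
        smooth_on (\<phi> ` T) (\<phi>' \<circ> F \<circ> inv_into U \<phi>))"

abbreviation smooth_fun_on ::
  "'a topology \<Rightarrow> ('a, 'e::euclidean_space) atlas \<Rightarrow> 'a set \<Rightarrow> ('a \<Rightarrow> real) \<Rightarrow> bool" where
  "smooth_fun_on V A S f \<equiv> smooth_map_on V A {(UNIV, id :: real \<Rightarrow> real)} S f"

definition smooth_fun_near ::
  "'a topology \<Rightarrow> ('a, 'e::euclidean_space) atlas \<Rightarrow> 'a \<Rightarrow> ('a \<Rightarrow> real) \<Rightarrow> bool" where
  "smooth_fun_near V A p f \<longleftrightarrow> (\<exists>S. openin V S \<and> p \<in> S \<and> smooth_fun_on V A S f)"

definition diffeomorphism ::
  "'a topology \<Rightarrow> ('a, 'e::euclidean_space) atlas \<Rightarrow> 'a set \<Rightarrow>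
   'b topology \<Rightarrow> ('b, 'f::euclidean_space) atlas \<Rightarrow> 'b set \<Rightarrow> ('a \<Rightarrow> 'b) \<Rightarrow> bool" where
  "diffeomorphism V A S W B T F \<longleftrightarrow> openin V S \<and> openin W T \<and> bij_betw F S T \<and>
     smooth_map_on V A B S F \<and> smooth_map_on W B A T (inv_into S F)"

section \<open>Tangent vectors and vector fields\<close>

text \<open>Tangent vectors at \<open>p\<close> are derivations of the algebra of germs at \<open>p\<close> of smooth
  functions. A derivation is encoded as a functional on all real functions that depends only
  on the germ and takes the dummy value 0 on functions that are not smooth near \<open>p\<close>.\<close>

type_synonym 'a tvec = "('a \<Rightarrow> real) \<Rightarrow> real"

definition tangent_space :: "'a topology \<Rightarrow> ('a, 'e::euclidean_space) atlas \<Rightarrow> 'a \<Rightarrow> 'a tvec set" where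
  "tangent_space V A p = {v.
     (\<forall>f g. smooth_fun_near V A p f \<and> smooth_fun_near V A p g \<longrightarrow>
        v (\<lambda>x. f x + g x) = v f + v g \<and>
        v (\<lambda>x. f x * g x) = v f * g p + f p * v g) \<and>
     (\<forall>r f. smooth_fun_near V A p f \<longrightarrow> v (\<lambda>x. r * f x) = r * v f) \<and>
     (\<forall>f g. smooth_fun_near V A p f \<and> (\<exists>S. openin V S \<and> p \<in> S \<and> (\<forall>x\<in>S. f x = g x)) \<longrightarrow>
        v f = v g) \<and>
     (\<forall>f. \<not> smooth_fun_near V A p f \<longrightarrow> v f = 0)}"

definition vector_field_on ::
  "'a topology \<Rightarrow> ('a, 'e::euclidean_space) atlas \<Rightarrow> 'a set \<Rightarrow> ('a \<Rightarrow> 'a tvec) \<Rightarrow> bool" where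
  "vector_field_on V A W X \<longleftrightarrow> (\<forall>p\<in>W. X p \<in> tangent_space V A p) \<and>
     (\<forall>S f. openin V S \<and> S \<subseteq> W \<and> smooth_fun_on V A S f \<longrightarrow> smooth_fun_on V A S (\<lambda>p. X p f))"

definition tangent_map ::
  "'b topology \<Rightarrow> ('b, 'f::euclidean_space) atlas \<Rightarrow> ('a \<Rightarrow> 'b) \<Rightarrow> 'a \<Rightarrow> 'a tvec \<Rightarrow> 'b tvec" where
  "tangent_map W B F p v = (\<lambda>g. if smooth_fun_near W B (F p) g then v (g \<circ> F) else 0)"

section \<open>A tangent space as a manifold\<close>

text \<open>Canonical topology of a finite-dimensional subspace \<open>E\<close>: the coarsest one for which all
  linear functionals are continuous.\<close>

definition vs_topology :: "'v::real_vector set \<Rightarrow> 'v topology" where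
  "vs_topology E = topology_generated_by
     {{x \<in> E. l x \<in> S} |l S. linear l \<and> open (S :: real set)}"

text \<open>Its global linear charts, onto the model space \<open>'e\<close> of the manifold, which has the same
  dimension.\<close>

definition tangent_atlas ::
  "'a topology \<Rightarrow> ('a, 'e::euclidean_space) atlas \<Rightarrow> 'a \<Rightarrow> ('a tvec, 'e) atlas" where
  "tangent_atlas V A c =
     {(tangent_space V A c, \<phi>) |\<phi>. linear \<phi> \<and> bij_betw \<phi> (tangent_space V A c) UNIV}"

text \<open>The canonical identification of \<open>E = T\<^sub>c V\<close> with its own tangent space at 0: a vector
  acts as the directional derivative at 0.\<close>

definition tangent_identification ::
  "'a topology \<Rightarrow> ('a, 'e::euclidean_space) atlas \<Rightarrow> 'a \<Rightarrow> 'a tvec \<Rightarrow> ('a tvec) tvec" where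
  "tangent_identification V A c v =
     (\<lambda>g. if smooth_fun_near (vs_topology (tangent_space V A c)) (tangent_atlas V A c) 0 g
          then deriv (\<lambda>t. g (t *\<^sub>R v)) 0 else 0)"

section \<open>Critical points and the Hessian\<close>

definition critical_point ::
  "'a topology \<Rightarrow> ('a, 'e::euclidean_space) atlas \<Rightarrow> ('a \<Rightarrow> real) \<Rightarrow> 'a \<Rightarrow> bool" where
  "critical_point V A f c \<longleftrightarrow> c \<in> topspace V \<and> (\<forall>v\<in>tangent_space V A c. v f = 0)"

text \<open>At a critical point the value does not depend on the germ of vector field \<open>X\<close> chosen
  to extend \<open>v\<close>.\<close>

definition hessian ::
  "'a topology \<Rightarrow> ('a, 'e::euclidean_space) atlas \<Rightarrow> ('a \<Rightarrow> real) \<Rightarrow> 'a \<Rightarrow> 'a tvec \<Rightarrow> real" where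
  "hessian V A f c v = (THE r. \<exists>W X. openin V W \<and> c \<in> W \<and> vector_field_on V A W X \<and> X c = v \<and>
     r = 1/2 * X c (\<lambda>p. X p f))"

definition assoc_bilinear :: "('v::real_vector \<Rightarrow> real) \<Rightarrow> 'v \<Rightarrow> 'v \<Rightarrow> real" where
  "assoc_bilinear q x y = q (x + y) - q x - q y"

definition dual_space :: "'v::real_vector set \<Rightarrow> ('v \<Rightarrow> real) set" where
  "dual_space E = (\<lambda>l. restrict l E) ` {l. linear l}"

text \<open>The map \<open>v \<mapsto> b v\<close> below is linear because \<open>b\<close> is symmetric and takes values in linear
  forms, so bijectivity is all that an isomorphism requires.\<close>

definition nondegenerate_critical_point ::
  "'a topology \<Rightarrow> ('a, 'e::euclidean_space) atlas \<Rightarrow> ('a \<Rightarrow> real) \<Rightarrow> 'a \<Rightarrow> bool" where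
  "nondegenerate_critical_point V A f c \<longleftrightarrow> critical_point V A f c \<and>
     bij_betw (\<lambda>v. restrict (assoc_bilinear (hessian V A f c) v) (tangent_space V A c))
       (tangent_space V A c) (dual_space (tangent_space V A c))"

section \<open>Linear algebra of quadratic forms\<close>

definition maximal_subspace :: "('v::real_vector set \<Rightarrow> bool) \<Rightarrow> 'v set \<Rightarrow> 'v set \<Rightarrow> bool" where
  "maximal_subspace Q E N \<longleftrightarrow> subspace N \<and> N \<subseteq> E \<and> Q N \<and>
     (\<forall>N'. subspace N' \<and> N' \<subseteq> E \<and> Q N' \<and> N \<subseteq> N' \<longrightarrow> N' = N)"

definition neg_def_on :: "('v::real_vector \<Rightarrow> real) \<Rightarrow> 'v set \<Rightarrow> bool" where
  "neg_def_on q N \<longleftrightarrow> (\<forall>x\<in>N. x \<noteq> 0 \<longrightarrow> q x < 0)"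

definition pos_def_on :: "('v::real_vector \<Rightarrow> real) \<Rightarrow> 'v set \<Rightarrow> bool" where
  "pos_def_on q P \<longleftrightarrow> (\<forall>x\<in>P. x \<noteq> 0 \<longrightarrow> q x > 0)"

definition orthogonal_in :: "('v \<Rightarrow> 'v \<Rightarrow> real) \<Rightarrow> 'v set \<Rightarrow> 'v set \<Rightarrow> 'v set" where
  "orthogonal_in b E N = {x \<in> E. \<forall>y\<in>N. b x y = 0}"

definition star_shaped_nhd :: "'v::real_vector set \<Rightarrow> 'v set \<Rightarrow> bool" where
  "star_shaped_nhd F S \<longleftrightarrow> openin (vs_topology F) S \<and> 0 \<in> S \<and> (\<forall>x\<in>S. closed_segment 0 x \<subseteq> S)"

end

theory Submission
  imports Defs
begin

text \<open>
  The tangent space \<open>T\<^sub>c V\<close> is identified with the model space by a chart at \<open>c\<close>: by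
  Hadamard's lemma a derivation at \<open>c\<close> is determined by its values on the coordinate
  functions, and every coordinate vector occurs (\<open>bij_tcoords\<close>). Under this identification the
  Hessian becomes half the second derivative of the local expression \<open>F\<close> of \<open>f\<close>
  (\<open>hessian_eq\<close>).

  The core is the Morse lemma in a Euclidean space, in a form that controls the derivative of the
  diffeomorphism. At a critical point \<open>x0\<close>, Hadamard's lemma applied twice gives
  \<open>F x = F x0 + (x - x0) \<bullet> H x (x - x0)\<close> with \<open>H x\<close> a symmetric matrix depending smoothly on
  \<open>x\<close>, and \<open>H x0\<close> the matrix of the Hessian form, invertible by non-degeneracy. The matrix
  \<open>(H x0)\<^sup>-\<^sup>1 H x\<close> is close to the identity, so it has a square root \<open>B x\<close> close to the identity
  and depending smoothly on \<open>x\<close>. It is self-adjoint for \<open>H x0\<close>, because the adjoint of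
  \<open>B x\<close> is another such square root. Therefore \<open>\<Phi> x = B x (x - x0)\<close> turns \<open>F - F x0\<close> into the
  quadratic form; its derivative at \<open>x0\<close> is the identity because \<open>B x0 = 1\<close>, and its local inverse
  is the required map (\<open>morse_lemma_matrix\<close>, \<open>morse_lemma_euclidean\<close>). Both the square root and this inverse are
  obtained from the inverse function theorem, completed by the smoothness of the inverse
  (\<open>smooth_inverse_function\<close>).

  The splitting \<open>E = N \<oplus> P\<close> is linear algebra: the form does not vanish on nonzero vectors of
  a definite subspace \<open>D\<close>, so \<open>D\<close> meets its orthogonal only in 0, and the
  orthogonal has codimension at most \<open>dim D\<close> (\<open>orthogonal_decomposition\<close>). The preimages of small balls
  under the two projections give star-shaped neighbourhoods whose sum lies in any given
  neighbourhood of 0 (\<open>star_shaped_sum_nhd\<close>).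
\<close>

section \<open>Maps of class $C^k$\<close>

lemma Ck_on_cong:
  assumes "open S" and "\<And>x. x \<in> S \<Longrightarrow> f x = g x" and "Ck_on k S f"
  shows "Ck_on k S g"
  using assms
proof (induction k arbitrary: f g)
  case 0
  then show ?case by (simp cong: continuous_on_cong)
next
  case (Suc k)
  have diff: "g differentiable (at x)" if "x \<in> S" for x
    using Suc.prems that
    by (metis Ck_on.simps(2) differentiable_def has_derivative_transform_within_open)
  have eq: "frechet_derivative f (at x) = frechet_derivative g (at x)" if "x \<in> S" for x
    using Suc.prems that by (intro frechet_derivative_transform_within_open) auto
  have "Ck_on k S (\<lambda>x. frechet_derivative g (at x) v)" for v
    by (rule Suc.IH[of "\<lambda>x. frechet_derivative f (at x) v"]) (use Suc.prems eq in auto)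
  with diff show ?case by simp
qed

lemma Ck_on_SucI:
  assumes "open S" and "\<And>x. x \<in> S \<Longrightarrow> (f has_derivative f' x) (at x)"
    and "\<And>v. Ck_on k S (\<lambda>x. f' x v)"
  shows "Ck_on (Suc k) S f"
proof -
  have "f' x = frechet_derivative f (at x)" if "x \<in> S" for x
    using assms(2)[OF that] by (rule frechet_derivative_at)
  then have "Ck_on k S (\<lambda>x. frechet_derivative f (at x) v)" for v
    using Ck_on_cong[OF assms(1) _ assms(3)[of v]] by simp
  moreover have "f differentiable (at x)" if "x \<in> S" for x
    using assms(2)[OF that] by (auto simp: differentiable_def)
  ultimately show ?thesis by simp
qed

lemma Ck_on_has_derivative:
  assumes "Ck_on (Suc k) S f" and "x \<in> S"
  shows "(f has_derivative frechet_derivative f (at x)) (at x)"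
  using assms by (metis Ck_on.simps(2) frechet_derivative_works)

lemma Ck_on_SucD: "Ck_on (Suc k) S f \<Longrightarrow> Ck_on k S f"
proof (induction k arbitrary: f)
  case 0
  then show ?case
    by (auto intro!: continuous_at_imp_continuous_on differentiable_imp_continuous_within)
next
  case (Suc k)
  then show ?case by simp
qed

lemma Ck_on_continuous: "Ck_on k S f \<Longrightarrow> continuous_on S f"
  by (induction k) (auto dest: Ck_on_SucD simp del: Ck_on.simps(2))

lemma Ck_on_subset: "Ck_on k S f \<Longrightarrow> T \<subseteq> S \<Longrightarrow> Ck_on k T f"
  by (induction k arbitrary: f) (auto intro: continuous_on_subset)

lemma Ck_on_local:
  assumes "\<And>x. x \<in> S \<Longrightarrow> \<exists>T. open T \<and> x \<in> T \<and> Ck_on k T f"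
  shows "Ck_on k S f"
  using assms
proof (induction k arbitrary: f)
  case 0
  then show ?case
    by (metis Ck_on.simps(1) continuous_at_imp_continuous_on continuous_on_eq_continuous_at)
next
  case (Suc k)
  have "Ck_on k S (\<lambda>x. frechet_derivative f (at x) v)" for v
    by (rule Suc.IH) (use Suc.prems in force)
  then show ?case using Suc.prems by fastforce
qed

lemma Ck_on_const: "open S \<Longrightarrow> Ck_on k S (\<lambda>x. c)"
  by (induction k arbitrary: c) (auto intro: continuous_intros)

lemma Ck_on_bounded_linear:
  assumes "bounded_linear L" and "open S" and "Ck_on k S f"
  shows "Ck_on k S (\<lambda>x. L (f x))"
  using assms(3)
proof (induction k arbitrary: f)
  case 0
  then show ?case
    using assms(1) by (auto intro: bounded_linear.continuous_on)
next
  case (Suc k)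
  show ?case
  proof (rule Ck_on_SucI[OF assms(2)])
    show "((\<lambda>x. L (f x)) has_derivative (\<lambda>v. L (frechet_derivative f (at x) v))) (at x)"
      if "x \<in> S" for x
      using bounded_linear.has_derivative[OF assms(1) Ck_on_has_derivative[OF Suc.prems that]] .
    show "Ck_on k S (\<lambda>x. L (frechet_derivative f (at x) v))" for v
      by (rule Suc.IH) (use Suc.prems in auto)
  qed
qed

lemma Ck_on_ident: "open S \<Longrightarrow> Ck_on k S (\<lambda>x. x)"
  by (cases k) (auto intro!: Ck_on_SucI[where f' = "\<lambda>x v. v"] Ck_on_const
      continuous_intros derivative_eq_intros simp del: Ck_on.simps(2))

lemma Ck_on_add:
  assumes "open S" and "Ck_on k S f" and "Ck_on k S g"
  shows "Ck_on k S (\<lambda>x. f x + g x)"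
  using assms(2,3)
proof (induction k arbitrary: f g)
  case 0
  then show ?case by (auto intro: continuous_intros)
next
  case (Suc k)
  show ?case
    by (rule Ck_on_SucI[OF assms(1) has_derivative_add[OF Ck_on_has_derivative[OF Suc.prems(1)]
            Ck_on_has_derivative[OF Suc.prems(2)]]])
      (use Suc in auto)
qed

lemma Ck_on_sum:
  assumes "open S" and "\<And>i. i \<in> I \<Longrightarrow> Ck_on k S (f i)"
  shows "Ck_on k S (\<lambda>x. \<Sum>i\<in>I. f i x)"
  using assms(2) by (induction I rule: infinite_finite_induct) (simp_all add: Ck_on_const Ck_on_add assms(1))

lemma Ck_on_bilinear:
  assumes "bounded_bilinear pr" and "open S" and "Ck_on k S f" and "Ck_on k S g"
  shows "Ck_on k S (\<lambda>x. pr (f x) (g x))"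
  using assms(3,4)
proof (induction k arbitrary: f g)
  case 0
  then show ?case
    using assms(1) by (auto intro: bounded_bilinear.continuous_on)
next
  case (Suc k)
  show ?case
  proof (rule Ck_on_SucI[OF assms(2) bounded_bilinear.FDERIV[OF assms(1)
        Ck_on_has_derivative[OF Suc.prems(1)] Ck_on_has_derivative[OF Suc.prems(2)]]])
    have "Ck_on k S f" "Ck_on k S g"
      using Suc.prems by (auto dest: Ck_on_SucD simp del: Ck_on.simps)
    then show "Ck_on k S (\<lambda>x. pr (f x) (frechet_derivative g (at x) v) +
        pr (frechet_derivative f (at x) v) (g x))" for v
      by (intro Ck_on_add assms(2) Suc.IH) (use Suc.prems in auto)
  qed
qed

lemma Ck_on_componentwise:
  fixes f :: "'a::real_normed_vector \<Rightarrow> 'b::euclidean_space"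
  assumes "open S" and "\<And>b. b \<in> Basis \<Longrightarrow> Ck_on k S (\<lambda>x. f x \<bullet> b)"
  shows "Ck_on k S f"
proof -
  have "Ck_on k S (\<lambda>x. \<Sum>b\<in>Basis. (f x \<bullet> b) *\<^sub>R b)"
    by (intro Ck_on_sum assms(1) Ck_on_bilinear[OF bounded_bilinear_scaleR] assms(2) Ck_on_const)
  then show ?thesis by (simp add: euclidean_representation)
qed

lemma linear_basis_expansion:
  fixes v :: "'a::euclidean_space"
  assumes "linear L" shows "L v = (\<Sum>b\<in>Basis. (v \<bullet> b) *\<^sub>R L b)"
proof -
  have "L v = L (\<Sum>b\<in>Basis. (v \<bullet> b) *\<^sub>R b)" by (simp add: euclidean_representation)
  also have "\<dots> = (\<Sum>b\<in>Basis. (v \<bullet> b) *\<^sub>R L b)"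
    by (simp add: linear_sum[OF assms] linear_scale[OF assms])
  finally show ?thesis .
qed

lemma Ck_on_compose:
  fixes f :: "'a::real_normed_vector \<Rightarrow> 'b::euclidean_space" and g :: "'b \<Rightarrow> 'c::real_normed_vector"
  assumes "open S" and "open T" and "Ck_on k S f" and "Ck_on k T g" and "f ` S \<subseteq> T"
  shows "Ck_on k S (\<lambda>x. g (f x))"
  using assms(3,4)
proof (induction k arbitrary: g)
  case 0
  then show ?case
    using assms(5) by (auto intro: continuous_on_compose2)
next
  case (Suc k)
  have f: "Ck_on k S f"
    using Suc.prems by (auto dest: Ck_on_SucD simp del: Ck_on.simps)
  let ?g' = "\<lambda>x. frechet_derivative g (at (f x))" and ?f' = "\<lambda>x. frechet_derivative f (at x)"
  show ?case
  proof (rule Ck_on_SucI[OF assms(1)])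
    fix x assume x: "x \<in> S"
    have f': "(f has_derivative ?f' x) (at x)" using Ck_on_has_derivative[OF Suc.prems(1) x] .
    have g': "(g has_derivative ?g' x) (at (f x))"
      using Ck_on_has_derivative[OF Suc.prems(2)] assms(5) x by blast
    have "((\<lambda>x. g (f x)) has_derivative (\<lambda>v. ?g' x (?f' x v))) (at x)"
      using has_derivative_compose[OF f' g'] .
    also have "(\<lambda>v. ?g' x (?f' x v)) = (\<lambda>v. \<Sum>b\<in>Basis. (?f' x v \<bullet> b) *\<^sub>R ?g' x b)"
      using linear_basis_expansion[OF has_derivative_linear[OF g']] by blast
    finally show "((\<lambda>x. g (f x)) has_derivative \<dots>) (at x)" .
  next
    fix v
    show "Ck_on k S (\<lambda>x. \<Sum>b\<in>Basis. (?f' x v \<bullet> b) *\<^sub>R ?g' x b)"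
    proof (intro Ck_on_sum assms(1) Ck_on_bilinear[OF bounded_bilinear_scaleR])
      fix b :: 'b assume "b \<in> Basis"
      show "Ck_on k S (\<lambda>x. ?f' x v \<bullet> b)"
        by (rule Ck_on_bounded_linear[OF bounded_linear_inner_left assms(1)]) (use Suc.prems in auto)
      show "Ck_on k S (\<lambda>x. ?g' x b)"
        by (rule Suc.IH[where g = "\<lambda>y. frechet_derivative g (at y) b"]) (use f Suc.prems in auto)
    qed
  qed
qed

text \<open>A product rule in which the second factor is only continuous; this suffices because the
  first factor vanishes at the point.\<close>

lemma has_derivative_scaleR_zero:
  fixes \<phi> :: "'a::real_normed_vector \<Rightarrow> real" and \<rho> :: "'a \<Rightarrow> 'b::real_normed_vector"
  assumes \<phi>: "(\<phi> has_derivative \<phi>') (at a)" and "\<phi> a = 0" and \<rho>: "isCont \<rho> a"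
  shows "((\<lambda>x. \<phi> x *\<^sub>R \<rho> x) has_derivative (\<lambda>v. \<phi>' v *\<^sub>R \<rho> a)) (at a)"
proof -
  have bl: "bounded_linear \<phi>'" using \<phi> by (rule has_derivative_bounded_linear)
  then obtain K where K: "\<And>v. norm (\<phi>' v) \<le> norm v * K" using bounded_linear.bounded by blast
  have lim: "((\<lambda>y. (1 / norm (y - a)) *\<^sub>R (\<phi> y - \<phi>' (y - a))) \<longlongrightarrow> 0) (at a)"
    using \<phi> \<open>\<phi> a = 0\<close> by (simp add: has_derivative_at_within divide_inverse mult.commute)
  have \<rho>': "(\<rho> \<longlongrightarrow> \<rho> a) (at a)" using \<rho> by (simp add: isCont_def)
  have "((\<lambda>y. ((1 / norm (y - a)) *\<^sub>R (\<phi> y - \<phi>' (y - a))) *\<^sub>R \<rho> y) \<longlongrightarrow> 0 *\<^sub>R \<rho> a) (at a)"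
    by (intro tendsto_scaleR lim \<rho>')
  moreover have "((\<lambda>y. (\<phi>' (y - a) / norm (y - a)) *\<^sub>R (\<rho> y - \<rho> a)) \<longlongrightarrow> 0) (at a)"
  proof (rule Lim_null_comparison)
    show "((\<lambda>y. \<bar>K\<bar> * norm (\<rho> y - \<rho> a)) \<longlongrightarrow> 0) (at a)"
      by (rule tendsto_eq_intros \<rho>' refl | simp)+
    have "norm ((\<phi>' (y - a) / norm (y - a)) *\<^sub>R (\<rho> y - \<rho> a)) \<le> \<bar>K\<bar> * norm (\<rho> y - \<rho> a)"
      if "y \<noteq> a" for y
    proof -
      have "\<bar>\<phi>' (y - a)\<bar> \<le> norm (y - a) * \<bar>K\<bar>"
        using K[of "y - a"] mult_left_mono[OF abs_ge_self[of K] norm_ge_zero[of "y - a"]] by simp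
      then have "\<bar>\<phi>' (y - a)\<bar> / norm (y - a) \<le> \<bar>K\<bar>" using that by (simp add: field_simps)
      from mult_right_mono[OF this norm_ge_zero[of "\<rho> y - \<rho> a"]] show ?thesis by simp
    qed
    then show "\<forall>\<^sub>F y in at a. norm ((\<phi>' (y - a) / norm (y - a)) *\<^sub>R (\<rho> y - \<rho> a)) \<le> \<bar>K\<bar> * norm (\<rho> y - \<rho> a)"
      by (simp add: eventually_at_filter del: norm_scaleR)
  qed
  ultimately have "((\<lambda>y. ((1 / norm (y - a)) *\<^sub>R (\<phi> y - \<phi>' (y - a))) *\<^sub>R \<rho> y +
      (\<phi>' (y - a) / norm (y - a)) *\<^sub>R (\<rho> y - \<rho> a)) \<longlongrightarrow> 0) (at a)"
    using tendsto_add by fastforce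
  then have "((\<lambda>y. (1 / norm (y - a)) *\<^sub>R (\<phi> y *\<^sub>R \<rho> y - \<phi>' (y - a) *\<^sub>R \<rho> a)) \<longlongrightarrow> 0) (at a)"
    by (simp add: algebra_simps divide_inverse)
  then show ?thesis
    unfolding has_derivative_at_within inverse_eq_divide
    using bounded_linear_scaleR_const[OF bl] \<open>\<phi> a = 0\<close> by simp
qed

lemma linear_two_sided_inverse:
  assumes "linear A" and AR: "\<And>v. A (R v) = v" and RA: "\<And>v. R (A v) = v"
  shows "linear R"
proof (rule linearI)
  show "R (x + y) = R x + R y" for x y
    using RA[of "R x + R y"] by (simp add: linear_add[OF assms(1)] AR)
  show "R (r *\<^sub>R x) = r *\<^sub>R R x" for r x
    using RA[of "r *\<^sub>R R x"] by (simp add: linear_scale[OF assms(1)] AR)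
qed

text \<open>The inverses are bounded near each point, because a lower bound \<open>norm u \<le> K * norm (A a u)\<close>
  at \<open>a\<close> persists, with \<open>2 * K\<close>, at nearby points.\<close>

lemma continuous_on_inverse_linear:
  fixes A R :: "'a::real_normed_vector \<Rightarrow> 'b::euclidean_space \<Rightarrow> 'b"
  assumes "open S"
    and lin: "\<And>x. x \<in> S \<Longrightarrow> linear (A x)"
    and AR: "\<And>x v. x \<in> S \<Longrightarrow> A x (R x v) = v" and RA: "\<And>x v. x \<in> S \<Longrightarrow> R x (A x v) = v"
    and cont: "\<And>u. continuous_on S (\<lambda>x. A x u)"
  shows "continuous_on S (\<lambda>x. R x v)"
proof -
  have "isCont (\<lambda>x. R x v) a" if a: "a \<in> S" for a
  proof -
    have linR: "linear (R a)"
      using linear_two_sided_inverse lin AR RA a by metis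
    obtain K where K: "K > 0" "\<And>w. norm (R a w) \<le> norm w * K"
      using bounded_linear.pos_bounded[OF linear_conv_bounded_linear[THEN iffD1, OF linR]] by blast
    have isC: "isCont (\<lambda>x. A x u) a" for u
      using cont continuous_on_eq_continuous_at assms(1) a by blast
    define d where "d = (\<lambda>x. \<Sum>b\<in>Basis. norm (A x b - A a b))"
    have "isCont d a" unfolding d_def by (intro continuous_intros isC)
    then have "(d \<longlongrightarrow> d a) (at a)" by (simp add: isCont_def)
    moreover have "d a < 1 / (2 * K)" using K by (simp add: d_def)
    ultimately have "\<forall>\<^sub>F x in at a. d x < 1 / (2 * K)" by (rule order_tendstoD)
    moreover have "\<forall>\<^sub>F x in at a. x \<in> S" using assms(1) a by (rule eventually_at_in_open')
    ultimately have ev: "\<forall>\<^sub>F x in at a. norm (R x v - R a v) \<le> 2 * K * norm (A a (R a v) - A x (R a v))"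
    proof eventually_elim
      case (elim x)
      have low: "norm u \<le> 2 * K * norm (A x u)" for u
      proof -
        have "A x u - A a u = (\<Sum>b\<in>Basis. (u \<bullet> b) *\<^sub>R (A x b - A a b))"
          using linear_basis_expansion[OF lin[OF elim(2)], of u] linear_basis_expansion[OF lin[OF a], of u]
          by (simp add: sum_subtractf scaleR_diff_right)
        then have "norm (A x u - A a u) \<le> (\<Sum>b\<in>Basis. norm ((u \<bullet> b) *\<^sub>R (A x b - A a b)))"
          by (metis norm_sum)
        also have "\<dots> \<le> (\<Sum>b\<in>Basis. norm u * norm (A x b - A a b))"
          by (intro sum_mono) (auto intro!: mult_right_mono Basis_le_norm)
        also have "\<dots> = norm u * d x" by (simp add: d_def sum_distrib_left)
        also have "\<dots> \<le> norm u * (1 / (2 * K))" using elim(1) by (intro mult_left_mono) auto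
        finally have 1: "norm (A x u - A a u) \<le> norm u / (2 * K)" by simp
        have "norm u = norm (R a (A a u))" using RA a by simp
        also have "\<dots> \<le> norm (A a u) * K" by (rule K)
        also have "\<dots> \<le> (norm (A x u) + norm (A x u - A a u)) * K"
          using K norm_triangle_ineq4[of "A x u" "A x u - A a u"] by (intro mult_right_mono) auto
        also have "\<dots> \<le> (norm (A x u) + norm u / (2 * K)) * K"
          using 1 K by (intro mult_right_mono) auto
        also have "\<dots> = norm (A x u) * K + norm u / 2" using K by (simp add: field_simps)
        finally show ?thesis by (simp add: algebra_simps)
      qed
      have "A x (R x v - R a v) = A a (R a v) - A x (R a v)"
        using AR a elim(2) linear_diff[OF lin[OF elim(2)]] by simp
      then show ?case using low[of "R x v - R a v"] by simp
    qed
    have "((\<lambda>x. 2 * K * norm (A a (R a v) - A x (R a v))) \<longlongrightarrow> 0) (at a)"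
      using isC[of "R a v"] unfolding isCont_def by - (rule tendsto_eq_intros refl | simp)+
    with ev have "((\<lambda>x. R x v - R a v) \<longlongrightarrow> 0) (at a)" by (rule Lim_null_comparison)
    then show ?thesis by (simp add: isCont_def LIM_zero_cancel)
  qed
  then show ?thesis by (simp add: continuous_at_imp_continuous_on)
qed

text \<open>Pointwise inversion of a $C^k$ family of linear maps is $C^k$: differentiating
  \<open>A x (R x v) = v\<close> gives the derivative \<open>- R x (A' x (R x v))\<close>, in which \<open>R\<close> occurs undifferentiated,
  so each order of differentiability yields the next.\<close>

lemma Ck_on_inverse_linear:
  fixes A R :: "'a::real_normed_vector \<Rightarrow> 'b::euclidean_space \<Rightarrow> 'b"
  assumes "open S"
    and lin: "\<And>x. x \<in> S \<Longrightarrow> linear (A x)"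
    and AR: "\<And>x v. x \<in> S \<Longrightarrow> A x (R x v) = v" and RA: "\<And>x v. x \<in> S \<Longrightarrow> R x (A x v) = v"
    and Ck: "\<And>u. Ck_on k S (\<lambda>x. A x u)"
  shows "Ck_on k S (\<lambda>x. R x v)"
  using Ck
proof (induction k arbitrary: v)
  case 0
  then show ?case using continuous_on_inverse_linear[OF assms(1) lin AR RA] by simp
next
  case (Suc k)
  have Ak: "Ck_on k S (\<lambda>x. A x u)" for u
    using Suc.prems by (auto dest: Ck_on_SucD simp del: Ck_on.simps)
  then have R: "Ck_on k S (\<lambda>x. R x u)" for u using Suc.IH by blast
  have linR: "linear (R x)" if "x \<in> S" for x
    using linear_two_sided_inverse lin AR RA that by metis
  define A' where "A' = (\<lambda>u x. frechet_derivative (\<lambda>x. A x u) (at x))"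
  have A': "((\<lambda>x. A x u) has_derivative A' u x) (at x)" if "x \<in> S" for x u
    unfolding A'_def using Ck_on_has_derivative[OF Suc.prems that] .
  have A'lin: "A' u x w = (\<Sum>c\<in>Basis. (u \<bullet> c) *\<^sub>R A' c x w)" if "x \<in> S" for x u w
  proof -
    have "((\<lambda>x. \<Sum>c\<in>Basis. (u \<bullet> c) *\<^sub>R A x c) has_derivative (\<lambda>w. \<Sum>c\<in>Basis. (u \<bullet> c) *\<^sub>R A' c x w)) (at x)"
      by (intro has_derivative_sum has_derivative_scaleR_right A' that)
    then have "((\<lambda>x. A x u) has_derivative (\<lambda>w. \<Sum>c\<in>Basis. (u \<bullet> c) *\<^sub>R A' c x w)) (at x)"
      by (rule has_derivative_transform_within_open[OF _ assms(1) that])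
        (simp add: linear_basis_expansion[OF lin, symmetric])
    then show ?thesis using has_derivative_unique[OF A'[OF that]] by simp
  qed
  show ?case
  proof (rule Ck_on_SucI[OF assms(1)])
    fix a assume a: "a \<in> S"
    have cont: "isCont (\<lambda>x. R x u) a" for u
      using Ck_on_continuous[OF R] continuous_on_eq_continuous_at assms(1) a by blast
    have "((\<lambda>x. \<Sum>b\<in>Basis. ((A a (R a v) - A x (R a v)) \<bullet> b) *\<^sub>R R x b) has_derivative
           (\<lambda>w. \<Sum>b\<in>Basis. ((- A' (R a v) a w) \<bullet> b) *\<^sub>R R a b)) (at a)"
      by (intro has_derivative_sum has_derivative_scaleR_zero cont)
        (auto intro!: derivative_eq_intros A' a)
    then have "((\<lambda>x. R a v + (\<Sum>b\<in>Basis. ((A a (R a v) - A x (R a v)) \<bullet> b) *\<^sub>R R x b)) has_derivative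
           (\<lambda>w. \<Sum>b\<in>Basis. ((- A' (R a v) a w) \<bullet> b) *\<^sub>R R a b)) (at a)"
      using has_derivative_add[OF has_derivative_const[of "R a v"]] by fastforce
    then show "((\<lambda>x. R x v) has_derivative
           (\<lambda>w. \<Sum>b\<in>Basis. ((- (\<Sum>c\<in>Basis. (R a v \<bullet> c) *\<^sub>R A' c a w)) \<bullet> b) *\<^sub>R R a b)) (at a)"
      unfolding A'lin[OF a, symmetric]
    proof (rule has_derivative_transform_within_open[OF _ assms(1) a])
      fix x assume x: "x \<in> S"
      have "(\<Sum>b\<in>Basis. ((A a (R a v) - A x (R a v)) \<bullet> b) *\<^sub>R R x b) = R x (A a (R a v) - A x (R a v))"
        using linear_basis_expansion[OF linR[OF x]] by metis
      also have "\<dots> = R x v - R a v"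
        using AR[OF a] RA[OF x] linear_diff[OF linR[OF x]] by simp
      finally show "R a v + (\<Sum>b\<in>Basis. ((A a (R a v) - A x (R a v)) \<bullet> b) *\<^sub>R R x b) = R x v" by simp
    qed
  next
    fix w
    have A'k: "Ck_on k S (\<lambda>x. A' c x w)" for c
      using Suc.prems unfolding A'_def by simp
    have inner: "Ck_on k S (\<lambda>x. f x \<bullet> b)" if "Ck_on k S f" for f :: "'a \<Rightarrow> 'b" and b
      using Ck_on_bounded_linear[OF bounded_linear_inner_left assms(1) that] .
    have "Ck_on k S (\<lambda>x. - (\<Sum>c\<in>Basis. (R x v \<bullet> c) *\<^sub>R A' c x w))"
      by (intro Ck_on_bounded_linear[OF bounded_linear_minus[OF bounded_linear_ident]] Ck_on_sum
          Ck_on_bilinear[OF bounded_bilinear_scaleR] assms(1) A'k inner R)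
    then show "Ck_on k S (\<lambda>x. \<Sum>b\<in>Basis. ((- (\<Sum>c\<in>Basis. (R x v \<bullet> c) *\<^sub>R A' c x w)) \<bullet> b) *\<^sub>R R x b)"
      by (intro Ck_on_sum Ck_on_bilinear[OF bounded_bilinear_scaleR] assms(1) inner R)
  qed
qed

section \<open>Smooth maps and the smooth inverse function theorem\<close>

lemma smooth_on_has_derivative:
  "smooth_on S f \<Longrightarrow> x \<in> S \<Longrightarrow> (f has_derivative frechet_derivative f (at x)) (at x)"
  unfolding smooth_on_def using Ck_on_has_derivative by blast

lemma smooth_on_continuous: "smooth_on S f \<Longrightarrow> continuous_on S f"
  unfolding smooth_on_def using Ck_on_continuous by blast

lemma smooth_on_subset: "smooth_on S f \<Longrightarrow> T \<subseteq> S \<Longrightarrow> smooth_on T f"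
  unfolding smooth_on_def using Ck_on_subset by blast

lemma smooth_on_cong:
  "open S \<Longrightarrow> (\<And>x. x \<in> S \<Longrightarrow> f x = g x) \<Longrightarrow> smooth_on S f \<Longrightarrow> smooth_on S g"
  unfolding smooth_on_def using Ck_on_cong by blast

lemma smooth_on_local:
  "(\<And>x. x \<in> S \<Longrightarrow> \<exists>T. open T \<and> x \<in> T \<and> smooth_on T f) \<Longrightarrow> smooth_on S f"
  unfolding smooth_on_def using Ck_on_local by meson

lemma smooth_on_const: "open S \<Longrightarrow> smooth_on S (\<lambda>x. c)"
  unfolding smooth_on_def using Ck_on_const by blast

lemma smooth_on_ident: "open S \<Longrightarrow> smooth_on S (\<lambda>x. x)"
  unfolding smooth_on_def using Ck_on_ident by blast

lemma smooth_on_add: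
  "open S \<Longrightarrow> smooth_on S f \<Longrightarrow> smooth_on S g \<Longrightarrow> smooth_on S (\<lambda>x. f x + g x)"
  unfolding smooth_on_def using Ck_on_add by blast

lemma smooth_on_bounded_linear:
  "bounded_linear L \<Longrightarrow> open S \<Longrightarrow> smooth_on S f \<Longrightarrow> smooth_on S (\<lambda>x. L (f x))"
  unfolding smooth_on_def using Ck_on_bounded_linear by blast

lemma smooth_on_bilinear:
  "bounded_bilinear pr \<Longrightarrow> open S \<Longrightarrow> smooth_on S f \<Longrightarrow> smooth_on S g \<Longrightarrow>
    smooth_on S (\<lambda>x. pr (f x) (g x))"
  unfolding smooth_on_def using Ck_on_bilinear by blast

lemma smooth_on_mult:
  fixes f g :: "'a::real_normed_vector \<Rightarrow> real"
  shows "open S \<Longrightarrow> smooth_on S f \<Longrightarrow> smooth_on S g \<Longrightarrow> smooth_on S (\<lambda>x. f x * g x)"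
  by (rule smooth_on_bilinear[OF bounded_bilinear_mult])

lemma smooth_on_componentwise:
  fixes f :: "'a::real_normed_vector \<Rightarrow> 'b::euclidean_space"
  shows "open S \<Longrightarrow> (\<And>b. b \<in> Basis \<Longrightarrow> smooth_on S (\<lambda>x. f x \<bullet> b)) \<Longrightarrow> smooth_on S f"
  by (auto simp: smooth_on_def intro: Ck_on_componentwise)

lemma smooth_on_inner_left:
  "open S \<Longrightarrow> smooth_on S f \<Longrightarrow> smooth_on S (\<lambda>x. f x \<bullet> b)"
  by (rule smooth_on_bounded_linear[OF bounded_linear_inner_left])

lemma smooth_on_compose:
  fixes f :: "'a::real_normed_vector \<Rightarrow> 'b::euclidean_space"
  shows "open S \<Longrightarrow> open T \<Longrightarrow> smooth_on S f \<Longrightarrow> smooth_on T g \<Longrightarrow> f ` S \<subseteq> T \<Longrightarrow>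
    smooth_on S (\<lambda>x. g (f x))"
  unfolding smooth_on_def using Ck_on_compose by blast

lemma smooth_on_derivative:
  "smooth_on S f \<Longrightarrow> smooth_on S (\<lambda>x. frechet_derivative f (at x) v)"
  unfolding smooth_on_def using Ck_on.simps(2) by blast

text \<open>The inverse provided by the inverse function theorem is smooth: its derivative is the
  pointwise inverse of the derivative of \<open>f\<close> composed with the inverse itself, so each order of
  differentiability yields the next.\<close>

lemma smooth_inverse_function:
  fixes f :: "'a::euclidean_space \<Rightarrow> 'a"
  assumes "open S" and "x0 \<in> S" and f: "smooth_on S f"
    and R: "linear R" "\<And>v. R (frechet_derivative f (at x0) v) = v"
  obtains U V g where "open U" and "x0 \<in> U" and "U \<subseteq> S" and "open V" and "homeomorphism U V f g"
    and "smooth_on V g"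
    and "\<And>y. y \<in> V \<Longrightarrow> (g has_derivative inv (frechet_derivative f (at (g y)))) (at y)"
proof -
  let ?D = "\<lambda>x. frechet_derivative f (at x)"
  define f' where "f' = (\<lambda>x. Blinfun (?D x))"
  have f': "blinfun_apply (f' x) = ?D x" if "x \<in> S" for x
    unfolding f'_def
    using smooth_on_has_derivative[OF f that] has_derivative_bounded_linear
    by (intro bounded_linear_Blinfun_apply) blast
  have cont: "continuous_on S f'"
  proof (rule continuous_on_blinfun_componentwise)
    fix i :: 'a
    have "continuous_on S (\<lambda>x. ?D x i)"
      by (rule smooth_on_continuous[OF smooth_on_derivative[OF f]])
    then show "continuous_on S (\<lambda>x. blinfun_apply (f' x) i)"
      by (simp add: f' cong: continuous_on_cong)
  qed
  have inv: "Blinfun R o\<^sub>L f' x0 = id_blinfun"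
    using R by (intro blinfun_eqI)
      (simp add: f' assms(2) bounded_linear_Blinfun_apply linear_conv_bounded_linear)
  have der: "(f has_derivative blinfun_apply (f' x)) (at x)" if "x \<in> S" for x
    using smooth_on_has_derivative[OF f that] f'[OF that] by simp
  obtain U V g g' where UV: "open U" "U \<subseteq> S" "x0 \<in> U" "open V" "f x0 \<in> V" "homeomorphism U V f g"
    and g0: "\<And>y. y \<in> V \<Longrightarrow> (g has_derivative (g' y)) (at y)"
      "\<And>y. y \<in> V \<Longrightarrow> g' y = inv (blinfun_apply (f'(g y)))"
      "\<And>y. y \<in> V \<Longrightarrow> bij (blinfun_apply (f'(g y)))"
    by (rule inverse_function_theorem[OF assms(1) der cont assms(2) inv]) blast+
  have gU: "g y \<in> U" if "y \<in> V" for y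
    using UV(6) that by (auto simp: homeomorphism_def)
  then have gS: "g y \<in> S" if "y \<in> V" for y using UV(2) that by blast
  have g: "(g has_derivative inv (?D (g y))) (at y)" and bij: "bij (?D (g y))" if "y \<in> V" for y
    using g0[OF that] f'[OF gS[OF that]] by auto
  have "Ck_on k V g" for k
  proof (induction k)
    case 0
    then show ?case using UV(6) by (simp add: homeomorphism_def)
  next
    case (Suc k)
    show ?case
    proof (rule Ck_on_SucI[OF UV(4) g])
      fix v
      show "Ck_on k V (\<lambda>y. inv (?D (g y)) v)"
      proof (rule Ck_on_inverse_linear[OF UV(4)])
        show "linear (?D (g y))" if "y \<in> V" for y
          using smooth_on_has_derivative[OF f gS[OF that]] has_derivative_linear by blast
        show "?D (g y) (inv (?D (g y)) v) = v" "inv (?D (g y)) (?D (g y) v) = v" if "y \<in> V" for y v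
          using bij[OF that] by (auto simp: bij_is_surj surj_f_inv_f bij_is_inj)
        show "Ck_on k V (\<lambda>y. ?D (g y) u)" for u
        proof (rule Ck_on_compose[where T = S and g = "\<lambda>x. ?D x u", OF UV(4) assms(1) Suc])
          show "Ck_on k S (\<lambda>x. ?D x u)"
            using smooth_on_derivative[OF f, of u] by (simp add: smooth_on_def)
        qed (use gS in blast)
      qed
    qed
  qed
  then have "smooth_on V g" by (simp add: smooth_on_def)
  with UV g that show thesis by blast
qed

section \<open>Hadamard's lemma\<close>

text \<open>Averages along rays; the factor \<open>t ^ m\<close> makes the family of these averages closed under
  differentiation.\<close>

lemma has_derivative_ray_integral:
  fixes h :: "'a::euclidean_space \<Rightarrow> real"
  assumes "open S" and "convex S" and "0 \<in> S" and h: "smooth_on S h" and "x \<in> S"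
  shows "((\<lambda>x. integral {0..1} (\<lambda>t. t ^ m * h (t *\<^sub>R x))) has_derivative
    (\<lambda>v. integral {0..1} (\<lambda>t. t ^ Suc m * frechet_derivative h (at (t *\<^sub>R x)) v))) (at x)"
proof -
  have tS: "t *\<^sub>R x \<in> S" if "x \<in> S" "t \<in> {0..1}" for t x
    using convexD_alt[OF assms(2) assms(3) that(1)] that(2) by force
  let ?D = "\<lambda>x. frechet_derivative h (at x)"
  define fx where "fx = (\<lambda>x t. t ^ Suc m *\<^sub>R Blinfun (?D (t *\<^sub>R x)))"
  have D: "(h has_derivative ?D (t *\<^sub>R x)) (at (t *\<^sub>R x))" if "x \<in> S" "t \<in> {0..1}" for x t
    using smooth_on_has_derivative[OF h tS[OF that]] .
  have fx: "blinfun_apply (fx x t) v = t ^ Suc m * ?D (t *\<^sub>R x) v" if "x \<in> S" "t \<in> {0..1}" for x t v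
    unfolding fx_def using D[OF that]
    by (simp add: blinfun.scaleR_left bounded_linear_Blinfun_apply has_derivative_bounded_linear)
  have cont: "continuous_on (S \<times> {0..1}) (\<lambda>(x, t). fx x t)"
  proof (rule continuous_on_blinfun_componentwise)
    fix i :: 'a
    have "continuous_on (S \<times> {0..1}) (\<lambda>p. snd p ^ Suc m * ?D (snd p *\<^sub>R fst p) i)"
      by (intro continuous_intros
          continuous_on_compose2[OF smooth_on_continuous[OF smooth_on_derivative[OF h]]])
        (use tS in auto)
    then show "continuous_on (S \<times> {0..1}) (\<lambda>p. blinfun_apply (case p of (x, t) \<Rightarrow> fx x t) i)"
      by (rule continuous_on_eq) (auto simp: fx)
  qed
  have 1: "((\<lambda>x. t ^ m * h (t *\<^sub>R x)) has_derivative blinfun_apply (fx x t)) (at x within S)"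
    if "x \<in> S" "t \<in> cbox 0 1" for x t
  proof -
    have t: "t \<in> {0..1}" using that by simp
    have lin: "linear (?D (t *\<^sub>R x))" using D[OF that(1) t] has_derivative_linear by blast
    have "((\<lambda>x. h (t *\<^sub>R x)) has_derivative (\<lambda>v. ?D (t *\<^sub>R x) (t *\<^sub>R v))) (at x within S)"
      by (rule has_derivative_compose[where f = "\<lambda>x. t *\<^sub>R x", OF _ D[OF that(1) t]]) (auto intro!: derivative_eq_intros)
    then have "((\<lambda>x. t ^ m * h (t *\<^sub>R x)) has_derivative (\<lambda>v. t ^ m * ?D (t *\<^sub>R x) (t *\<^sub>R v))) (at x within S)"
      by (rule has_derivative_mult_right)
    moreover have "(\<lambda>v. t ^ m * ?D (t *\<^sub>R x) (t *\<^sub>R v)) = blinfun_apply (fx x t)"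
      by (simp add: fun_eq_iff fx[OF that(1) t] linear_scale[OF lin])
    ultimately show ?thesis by simp
  qed
  have 2: "(\<lambda>t. t ^ m * h (t *\<^sub>R x)) integrable_on cbox 0 1" if "x \<in> S" for x
    by (intro integrable_continuous continuous_intros
        continuous_on_compose2[OF smooth_on_continuous[OF h]]) (use tS that in auto)
  have "((\<lambda>x. integral (cbox 0 1) (\<lambda>t. t ^ m * h (t *\<^sub>R x))) has_derivative
      integral (cbox 0 1) (fx x)) (at x within S)"
    by (rule leibniz_rule[OF 1 2 _ assms(5,2)]) (use cont in auto)
  moreover have "blinfun_apply (integral (cbox 0 1) (fx x)) =
      (\<lambda>v. integral {0..1} (\<lambda>t. t ^ Suc m * ?D (t *\<^sub>R x) v))"
  proof
    fix v
    have "continuous_on {0..1} (Pair x)" by (intro continuous_intros)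
    then have "continuous_on (cbox 0 1) (fx x)"
      using continuous_on_compose2[OF cont, of "{0..1}" "Pair x"] assms(5)
      by (auto simp: image_subset_iff)
    then have "fx x integrable_on cbox 0 1" by (rule integrable_continuous)
    then have "blinfun_apply (integral (cbox 0 1) (fx x)) v = integral (cbox 0 1) (\<lambda>t. fx x t v)"
      by (rule blinfun_apply_integral)
    also have "\<dots> = integral {0..1} (\<lambda>t. t ^ Suc m * ?D (t *\<^sub>R x) v)"
      unfolding interval_cbox using assms(5) by (intro integral_cong) (simp add: fx)
    finally show "blinfun_apply (integral (cbox 0 1) (fx x)) v = \<dots>" .
  qed
  ultimately show ?thesis
    using at_within_open[OF assms(5,1)] by simp
qed

lemma smooth_on_ray_integral:
  fixes h :: "'a::euclidean_space \<Rightarrow> real"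
  assumes "open S" and "convex S" and "0 \<in> S" and "smooth_on S h"
  shows "smooth_on S (\<lambda>x. integral {0..1} (\<lambda>t. t ^ m * h (t *\<^sub>R x)))"
proof -
  have "Ck_on k S (\<lambda>x. integral {0..1} (\<lambda>t. t ^ m * h (t *\<^sub>R x)))" for k
    using assms(4)
  proof (induction k arbitrary: h m)
    case 0
    then show ?case
      using has_derivative_continuous[OF has_derivative_ray_integral[OF assms(1,2,3)]]
      by (simp add: continuous_at_imp_continuous_on)
  next
    case (Suc k)
    show ?case
      by (rule Ck_on_SucI[OF assms(1) has_derivative_ray_integral[OF assms(1,2,3) Suc.prems]])
        (use Suc smooth_on_derivative in blast)+
  qed
  then show ?thesis by (simp add: smooth_on_def)
qed

text \<open>Hadamard's lemma: the coefficients are the averages of the partial derivatives along the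
  segments from the base point.\<close>

lemma hadamard_at_0:
  fixes h :: "'a::euclidean_space \<Rightarrow> real"
  assumes "open S" and "convex S" and "0 \<in> S" and h: "smooth_on S h"
  obtains g where "\<And>b. smooth_on S (g b)"
    and "\<And>x. x \<in> S \<Longrightarrow> h x = h 0 + (\<Sum>b\<in>Basis. (x \<bullet> b) * g b x)"
    and "\<And>b. g b 0 = frechet_derivative h (at 0) b"
proof -
  let ?D = "\<lambda>x. frechet_derivative h (at x)"
  define g where "g = (\<lambda>b x. integral {0..1} (\<lambda>t. t ^ 0 * ?D (t *\<^sub>R x) b))"
  have "smooth_on S (g b)" for b
    unfolding g_def by (rule smooth_on_ray_integral[OF assms(1-3) smooth_on_derivative[OF h]])
  moreover have "h x = h 0 + (\<Sum>b\<in>Basis. (x \<bullet> b) * g b x)" if x: "x \<in> S" for x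
  proof -
    have tS: "t *\<^sub>R x \<in> S" if "t \<in> {0..1}" for t
      using convexD_alt[OF assms(2) assms(3) x] that by force
    have D: "(h has_derivative ?D (t *\<^sub>R x)) (at (t *\<^sub>R x))" if "t \<in> {0..1}" for t
      using smooth_on_has_derivative[OF h tS[OF that]] .
    have "((\<lambda>t. h (t *\<^sub>R x)) has_vector_derivative ?D (t *\<^sub>R x) x) (at t within {0..1})"
      if t: "t \<in> {0..1}" for t
    proof -
      have lin: "linear (?D (t *\<^sub>R x))" using D[OF t] has_derivative_linear by blast
      have "((\<lambda>t. h (t *\<^sub>R x)) has_derivative (\<lambda>s. ?D (t *\<^sub>R x) (s *\<^sub>R x))) (at t within {0..1})"
        by (rule has_derivative_compose[where f = "\<lambda>t. t *\<^sub>R x", OF _ D[OF t]]) (auto intro!: derivative_eq_intros)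
      then show ?thesis by (simp add: has_vector_derivative_def linear_scale[OF lin])
    qed
    then have "((\<lambda>t. ?D (t *\<^sub>R x) x) has_integral (h (1 *\<^sub>R x) - h (0 *\<^sub>R x))) {0..1}"
      by (intro fundamental_theorem_of_calculus) auto
    then have "h x - h 0 = integral {0..1} (\<lambda>t. ?D (t *\<^sub>R x) x)" by (simp add: integral_unique)
    also have "\<dots> = integral {0..1} (\<lambda>t. \<Sum>b\<in>Basis. (x \<bullet> b) * ?D (t *\<^sub>R x) b)"
      using linear_basis_expansion[OF has_derivative_linear[OF D]]
      by (intro integral_cong) simp
    also have "\<dots> = (\<Sum>b\<in>Basis. integral {0..1} (\<lambda>t. (x \<bullet> b) * ?D (t *\<^sub>R x) b))"
    proof (rule integral_sum)
      show "(\<lambda>t. (x \<bullet> b) * ?D (t *\<^sub>R x) b) integrable_on {0..1}" for b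
        by (intro integrable_continuous_real continuous_intros
            continuous_on_compose2[OF smooth_on_continuous[OF smooth_on_derivative[OF h]]])
          (use tS in auto)
    qed simp
    also have "\<dots> = (\<Sum>b\<in>Basis. (x \<bullet> b) * g b x)" by (simp add: g_def)
    finally show ?thesis by simp
  qed
  moreover have "g b 0 = ?D 0 b" for b by (simp add: g_def)
  ultimately show thesis using that by blast
qed

lemma hadamard:
  fixes h :: "'a::euclidean_space \<Rightarrow> real"
  assumes "open S" and "convex S" and "x0 \<in> S" and h: "smooth_on S h"
  obtains g where "\<And>b. smooth_on S (g b)"
    and "\<And>x. x \<in> S \<Longrightarrow> h x = h x0 + (\<Sum>b\<in>Basis. ((x - x0) \<bullet> b) * g b x)"
    and "\<And>b. g b x0 = frechet_derivative h (at x0) b"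
proof -
  let ?S = "(\<lambda>x. x - x0) ` S"
  have S': "open ?S" "convex ?S" "0 \<in> ?S"
    using assms by (auto simp: convex_translation_subtract image_iff open_translation_subtract)
  have "smooth_on ?S (\<lambda>y. y + x0)"
    by (intro smooth_on_add smooth_on_ident smooth_on_const S')
  then have "smooth_on ?S (\<lambda>y. h (y + x0))"
    by (intro smooth_on_compose[OF S'(1) assms(1) _ h]) auto
  then obtain g where g: "\<And>b. smooth_on ?S (g b)"
    "\<And>y. y \<in> ?S \<Longrightarrow> h (y + x0) = h (0 + x0) + (\<Sum>b\<in>Basis. (y \<bullet> b) * g b y)"
    "\<And>b. g b 0 = frechet_derivative (\<lambda>y. h (y + x0)) (at 0) b"
    using hadamard_at_0[OF S'] by blast
  have "((\<lambda>y. h (y + x0)) has_derivative frechet_derivative h (at x0)) (at 0)"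
    using has_derivative_compose[of "\<lambda>y. y + x0" "\<lambda>y. y" 0 UNIV h "frechet_derivative h (at x0)"]
      smooth_on_has_derivative[OF h assms(3)]
    by (simp add: has_derivative_add_const)
  then have "frechet_derivative (\<lambda>y. h (y + x0)) (at 0) = frechet_derivative h (at x0)"
    by (rule frechet_derivative_at[symmetric])
  moreover have "smooth_on S (\<lambda>x. x + - x0)"
    by (intro smooth_on_add smooth_on_ident smooth_on_const assms)
  then have "smooth_on S (\<lambda>x. g b (x - x0))" for b
    by (intro smooth_on_compose[OF assms(1) S'(1) _ g(1)]) auto
  moreover have "h x = h x0 + (\<Sum>b\<in>Basis. ((x - x0) \<bullet> b) * g b (x - x0))" if "x \<in> S" for x
    using g(2)[of "x - x0"] that by simp
  ultimately show thesis using that[of "\<lambda>b x. g b (x - x0)"] g(3) by simp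
qed

section \<open>The Morse lemma in Euclidean space\<close>

lemma smooth_on_vec:
  fixes f :: "'a::real_normed_vector \<Rightarrow> 'b::euclidean_space ^ 'n"
  assumes "open S" and "\<And>i. smooth_on S (\<lambda>x. f x $ i)"
  shows "smooth_on S f"
proof (rule smooth_on_componentwise[OF assms(1)])
  fix b :: "'b ^ 'n" assume "b \<in> Basis"
  then obtain i u where "b = axis i u" by (auto simp: Basis_vec_def)
  then show "smooth_on S (\<lambda>x. f x \<bullet> b)"
    using smooth_on_inner_left[OF assms(1,2)] by (simp add: inner_axis)
qed

lemma bounded_bilinear_matrix_mult:
  "bounded_bilinear ((**) :: real^'n^'m \<Rightarrow> real^'k^'n \<Rightarrow> real^'k^'m)"
  unfolding bilinear_conv_bounded_bilinear[symmetric] bilinear_def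
  by (auto intro!: linearI simp: matrix_matrix_mult_def vec_eq_iff algebra_simps sum.distrib
      sum_distrib_left)

lemma bounded_bilinear_matrix_vector_mult:
  "bounded_bilinear ((*v) :: real^'n^'m \<Rightarrow> real^'n \<Rightarrow> real^'m)"
  unfolding bilinear_conv_bounded_bilinear[symmetric] bilinear_def
  by (auto intro!: linearI simp: matrix_vector_mult_add_rdistrib matrix_vector_right_distrib
      scaleR_matrix_vector_assoc matrix_vector_mult_scaleR)

text \<open>Near the identity, squaring of matrices is a diffeomorphism, as its derivative there is
  twice the identity.\<close>

lemma smooth_matrix_sqrt:
  obtains U V and g :: "real^'n^'n \<Rightarrow> real^'n^'n" where "open U" and "mat 1 \<in> U" and "open V" and "mat 1 \<in> V"
    and "smooth_on V g" and "\<And>M. M \<in> V \<Longrightarrow> g M ** g M = M" and "\<And>M. M \<in> U \<Longrightarrow> g (M ** M) = M"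
proof -
  let ?sq = "\<lambda>M :: real^'n^'n. M ** M"
  have sm: "smooth_on UNIV ?sq"
    by (intro smooth_on_bilinear[OF bounded_bilinear_matrix_mult] smooth_on_ident open_UNIV)
  have "(?sq has_derivative (\<lambda>W. mat 1 ** W + W ** mat 1)) (at (mat 1))"
    by (rule bounded_bilinear.FDERIV[OF bounded_bilinear_matrix_mult has_derivative_ident has_derivative_ident])
  then have D: "frechet_derivative ?sq (at (mat 1)) = (\<lambda>W. mat 1 ** W + W ** mat 1)"
    by (rule frechet_derivative_at[symmetric])
  have R: "linear (\<lambda>W :: real^'n^'n. (1/2) *\<^sub>R W)"
    by (intro linearI) (simp_all add: scaleR_add_right)
  have R': "(1/2) *\<^sub>R frechet_derivative ?sq (at (mat 1)) W = W" for W :: "real^'n^'n"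
    unfolding D by (simp flip: scaleR_2)
  obtain U V g where *: "open U" "mat 1 \<in> U" "U \<subseteq> UNIV" "open V" "homeomorphism U V ?sq g" "smooth_on V g"
    by (rule smooth_inverse_function[OF open_UNIV UNIV_I sm R R']) blast
  have "?sq (mat 1) \<in> V" using *(2,5) unfolding homeomorphism_def by blast
  then have "mat 1 \<in> V" by simp
  with * show thesis by (intro that[of U V g]) (auto simp: homeomorphism_def)
qed

text \<open>The Morse lemma for functions of the form \<open>x \<bullet> (H x *v x)\<close>. With \<open>K\<close> the inverse
  of \<open>H 0\<close> and \<open>B x\<close> the square root of \<open>K ** H x\<close> near the identity, \<open>B x\<close> is self-adjoint
  with respect to \<open>H 0\<close>, because its adjoint is another square root near the identity of the same
  self-adjoint matrix. Hence \<open>\<Phi> x = B x *v x\<close> satisfies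
  \<open>\<Phi> x \<bullet> (H 0 *v \<Phi> x) = x \<bullet> (H 0 *v (B x *v (B x *v x))) = x \<bullet> (H x *v x)\<close>.\<close>

lemma morse_lemma_matrix:
  fixes H :: "real^'n \<Rightarrow> real^'n^'n"
  assumes "open S" and "0 \<in> S" and H: "smooth_on S H"
    and sym: "\<And>x. x \<in> S \<Longrightarrow> transpose (H x) = H x" and inv: "invertible (H 0)"
  obtains W T \<psi> \<Phi> where "open W" and "open T" and "0 \<in> W" and "T \<subseteq> S"
    and "\<psi> ` W \<subseteq> T" and "\<Phi> ` T \<subseteq> W" and "\<And>y. y \<in> W \<Longrightarrow> \<Phi> (\<psi> y) = y"
    and "\<And>x. x \<in> T \<Longrightarrow> \<psi> (\<Phi> x) = x" and "smooth_on W \<psi>" and "smooth_on T \<Phi>"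
    and "\<psi> 0 = 0" and "(\<psi> has_derivative (\<lambda>v. v)) (at 0)"
    and "\<And>y. y \<in> W \<Longrightarrow> \<psi> y \<bullet> (H (\<psi> y) *v \<psi> y) = y \<bullet> (H 0 *v y)"
proof -
  obtain K where K: "K ** H 0 = mat 1" "H 0 ** K = mat 1"
    using inv by (auto simp: invertible_def)
  have "transpose K ** H 0 = mat 1"
    using arg_cong[OF K(2), of transpose] sym[OF assms(2)] by (simp add: matrix_transpose_mul transpose_mat)
  then have "transpose K ** H 0 ** K = mat 1 ** K" by simp
  then have Ksym: "transpose K = K" by (simp add: K(2) flip: matrix_mul_assoc)
  obtain U V and g :: "real^'n^'n \<Rightarrow> real^'n^'n" where UV: "open U" "mat 1 \<in> U" "open V" "mat 1 \<in> V"
    and g: "smooth_on V g" and gg: "\<And>M. M \<in> V \<Longrightarrow> g M ** g M = M" and gU: "\<And>M. M \<in> U \<Longrightarrow> g (M ** M) = M"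
    by (rule smooth_matrix_sqrt) blast
  have g1: "g (mat 1) = mat 1" using gU[OF UV(2)] by simp
  \<comment> \<open>The family whose square root is taken.\<close>
  define S' where "S' = (\<lambda>x. K ** H x)"
  have S': "smooth_on S S'"
    unfolding S'_def
    by (intro smooth_on_bilinear[OF bounded_bilinear_matrix_mult] smooth_on_const assms(1) H)
  have S'0: "S' 0 = mat 1" by (simp add: S'_def K)
  \<comment> \<open>The adjoint with respect to the form with matrix \<open>H 0\<close>, an anti-automorphism that fixes
    the self-adjoint \<open>S' x\<close>.\<close>
  define adj where "adj = (\<lambda>M. K ** transpose M ** H 0)"
  have adj_mult: "adj (M ** N) = adj N ** adj M" for M N
  proof -
    have "adj N ** adj M = K ** transpose N ** (H 0 ** K) ** transpose M ** H 0"
      by (simp only: adj_def matrix_mul_assoc)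
    then show ?thesis by (simp add: K(2) adj_def matrix_transpose_mul matrix_mul_assoc)
  qed
  have adjS': "adj (S' x) = S' x" if "x \<in> S" for x
    using sym[OF that] Ksym K(1)
    by (simp add: adj_def S'_def matrix_transpose_mul flip: matrix_mul_assoc)
  define B where "B = (\<lambda>x. g (S' x))"
  define S2 where "S2 = S \<inter> S' -` V"
  have S2: "open S2"
    unfolding S2_def by (rule continuous_open_preimage[OF smooth_on_continuous[OF S'] assms(1) UV(3)])
  have B: "smooth_on S2 B"
    unfolding B_def
    by (rule smooth_on_compose[OF S2 UV(3) smooth_on_subset[OF S'] g]) (auto simp: S2_def)
  have "linear (transpose :: real^'n^'n \<Rightarrow> real^'n^'n)"
    by (intro linearI) (simp_all add: transpose_def vec_eq_iff)
  then have "bounded_linear (transpose :: real^'n^'n \<Rightarrow> real^'n^'n)"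
    by (simp add: linear_conv_bounded_linear)
  then have "smooth_on S2 (\<lambda>x. adj (B x))"
    unfolding adj_def
    by (intro smooth_on_bilinear[OF bounded_bilinear_matrix_mult] smooth_on_const S2
        smooth_on_bounded_linear[where L = transpose] B)
  then have contadj: "continuous_on S2 (\<lambda>x. adj (B x))" by (rule smooth_on_continuous)
  \<comment> \<open>On \<open>S1\<close> the adjoint of \<open>B x\<close> stays in the neighbourhood \<open>U\<close>, where square roots are unique.\<close>
  define S1 where "S1 = S2 \<inter> (\<lambda>x. adj (B x)) -` U"
  have S1: "open S1"
    unfolding S1_def by (rule continuous_open_preimage[OF contadj S2 UV(1)])
  have B0: "B 0 = mat 1" by (simp add: B_def S'0 g1)
  have S10: "0 \<in> S1"
    using assms(2) UV B0 by (simp add: S1_def S2_def S'0 adj_def transpose_mat K)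
  have S1S: "S1 \<subseteq> S" by (auto simp: S1_def S2_def)
  have BB: "B x ** B x = S' x" if "x \<in> S1" for x
    using gg[of "S' x"] that by (simp add: B_def S1_def S2_def)
  have HB: "transpose (B x) ** H 0 = H 0 ** B x" if x: "x \<in> S1" for x
  proof -
    have "adj (B x) ** adj (B x) = S' x"
      using BB[OF x] adjS' S1S x by (auto simp flip: adj_mult)
    then have "adj (B x) = B x"
      using gU[of "adj (B x)"] x by (simp add: S1_def B_def)
    then have "H 0 ** B x = (H 0 ** K) ** transpose (B x) ** H 0"
      by (metis adj_def matrix_mul_assoc)
    then show ?thesis by (simp add: K(2))
  qed
  define \<Phi> where "\<Phi> = (\<lambda>x. B x *v x)"
  have B1: "smooth_on S1 B" by (rule smooth_on_subset[OF B]) (auto simp: S1_def)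
  have \<Phi>: "smooth_on S1 \<Phi>"
    unfolding \<Phi>_def
    by (intro smooth_on_bilinear[OF bounded_bilinear_matrix_vector_mult] smooth_on_ident S1 B1)
  have form: "\<Phi> x \<bullet> (H 0 *v \<Phi> x) = x \<bullet> (H x *v x)" if x: "x \<in> S1" for x
  proof -
    have "\<Phi> x \<bullet> (H 0 *v \<Phi> x) = x \<bullet> (transpose (B x) *v (H 0 *v \<Phi> x))"
      by (metis \<Phi>_def dot_lmul_matrix transpose_matrix_vector transpose_transpose)
    also have "\<dots> = x \<bullet> ((transpose (B x) ** H 0 ** B x) *v x)"
      by (simp add: \<Phi>_def matrix_vector_mul_assoc matrix_mul_assoc)
    also have "transpose (B x) ** H 0 ** B x = H 0 ** K ** H x"
      using HB[OF x] BB[OF x] by (simp add: S'_def flip: matrix_mul_assoc)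
    finally show ?thesis by (simp add: K(2))
  qed
  have \<Phi>0: "\<Phi> 0 = 0" by (simp add: \<Phi>_def)
  have "(\<Phi> has_derivative (\<lambda>v. B 0 *v v + frechet_derivative B (at 0) v *v 0)) (at 0)"
    unfolding \<Phi>_def
    by (rule bounded_bilinear.FDERIV[OF bounded_bilinear_matrix_vector_mult
          smooth_on_has_derivative[OF B1 S10] has_derivative_ident])
  then have D\<Phi>: "frechet_derivative \<Phi> (at 0) = (\<lambda>v. v)"
    using frechet_derivative_at[of \<Phi>] by (simp add: B0)
  obtain T W \<psi> where *: "open T" "0 \<in> T" "T \<subseteq> S1" "open W" "homeomorphism T W \<Phi> \<psi>" "smooth_on W \<psi>"
    and d\<psi>: "\<And>y. y \<in> W \<Longrightarrow> (\<psi> has_derivative inv (frechet_derivative \<Phi> (at (\<psi> y)))) (at y)"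
    by (rule smooth_inverse_function[OF S1 S10 \<Phi>, of "\<lambda>v. v"]) (auto simp: D\<Phi> linear_ident)
  have hom: "\<psi> ` W \<subseteq> T" "\<Phi> ` T \<subseteq> W" "\<And>y. y \<in> W \<Longrightarrow> \<Phi> (\<psi> y) = y" "\<And>x. x \<in> T \<Longrightarrow> \<psi> (\<Phi> x) = x"
    using *(5) by (auto simp: homeomorphism_def)
  have W0: "0 \<in> W" using hom(2) *(2) \<Phi>0 by force
  have \<psi>0: "\<psi> 0 = 0" using hom(4)[OF *(2)] \<Phi>0 by simp
  have "(\<psi> has_derivative (\<lambda>v. v)) (at 0)"
    using d\<psi>[OF W0] by (simp add: \<psi>0 D\<Phi> inv_id[unfolded id_def])
  moreover have "\<psi> y \<bullet> (H (\<psi> y) *v \<psi> y) = y \<bullet> (H 0 *v y)" if "y \<in> W" for y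
    using form[of "\<psi> y"] hom(1,3) that *(3) by (auto simp: image_subset_iff)
  ultimately show thesis
    using * hom W0 \<psi>0 S1S smooth_on_subset[OF \<Phi> *(3)] by (intro that[of W T \<psi> \<Phi>]) auto
qed

text \<open>A finite index type for the standard basis, which turns a Euclidean space of unnamed
  dimension into a space of coordinate vectors, on which linear maps are matrices.\<close>

typedef (overloaded) ('e::euclidean_space) basis_index = "Basis :: 'e set"
  using nonempty_Basis by blast

instance basis_index :: (euclidean_space) finite
proof
  have "(UNIV :: 'a basis_index set) = Abs_basis_index ` Basis"
    by (rule type_definition.Abs_image[OF type_definition_basis_index, symmetric])
  then show "finite (UNIV :: 'a basis_index set)" by (metis finite_Basis finite_imageI)
qed

lemma sum_basis_index: "(\<Sum>i\<in>UNIV. f (Rep_basis_index i)) = (\<Sum>b\<in>Basis. f (b :: 'e::euclidean_space))"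
proof (rule sum.reindex_bij_betw)
  show "bij_betw (Rep_basis_index :: 'e basis_index \<Rightarrow> 'e) UNIV Basis"
    by (simp add: bij_betw_def inj_def Rep_basis_index_inject
        type_definition.Rep_range[OF type_definition_basis_index])
qed

text \<open>The coordinate vector in the standard basis, and its inverse.\<close>

definition coords :: "'e::euclidean_space \<Rightarrow> real ^ 'e basis_index" where
  "coords x = (\<chi> i. x \<bullet> Rep_basis_index i)"

definition of_coords :: "real ^ 'e basis_index \<Rightarrow> 'e::euclidean_space" where
  "of_coords z = (\<Sum>i\<in>UNIV. z $ i *\<^sub>R Rep_basis_index i)"

lemma of_coords_coords [simp]: "of_coords (coords x) = x"
  using sum_basis_index[of "\<lambda>b. (x \<bullet> b) *\<^sub>R b"]
  by (simp add: of_coords_def coords_def euclidean_representation)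

lemma coords_of_coords [simp]: "coords (of_coords z) = z"
proof -
  have "Rep_basis_index i \<bullet> (Rep_basis_index j :: 'a) = of_bool (i = j)" for i j
    using inner_Basis[OF Rep_basis_index[of i] Rep_basis_index[of j]] by (simp add: Rep_basis_index_inject)
  then show ?thesis
    by (simp add: of_coords_def coords_def vec_eq_iff inner_sum_left)
qed

lemma linear_coords: "linear coords"
  by (intro linearI) (simp_all add: coords_def vec_eq_iff inner_add_left)

lemma linear_of_coords: "linear of_coords"
  by (intro linearI) (simp_all add: of_coords_def scaleR_add_left sum.distrib scaleR_sum_right)

text \<open>The quadratic form with coefficients \<open>a\<close>, which need not be symmetric.\<close>

definition coeff_form :: "('e \<Rightarrow> 'e \<Rightarrow> real) \<Rightarrow> 'e::euclidean_space \<Rightarrow> real" where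
  "coeff_form a w = (\<Sum>b\<in>Basis. \<Sum>b'\<in>Basis. (w \<bullet> b) * (w \<bullet> b') * a b b')"

text \<open>Its symmetric matrix in the standard basis.\<close>

definition coeff_matrix :: "('e \<Rightarrow> 'e \<Rightarrow> real) \<Rightarrow> real ^ 'e basis_index ^ 'e::euclidean_space basis_index" where
  "coeff_matrix a = (\<chi> i j. (a (Rep_basis_index i) (Rep_basis_index j) +
     a (Rep_basis_index j) (Rep_basis_index i)) / 2)"

lemma transpose_coeff_matrix: "transpose (coeff_matrix a) = coeff_matrix a"
  by (simp add: transpose_def coeff_matrix_def vec_eq_iff add.commute)

lemma coeff_form_eq_matrix: "coeff_form a w = coords w \<bullet> (coeff_matrix a *v coords w)"
proof -
  let ?r = "Rep_basis_index :: 'a basis_index \<Rightarrow> 'a"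
  let ?t = "\<lambda>i j. (w \<bullet> ?r i) * (w \<bullet> ?r j) * a (?r i) (?r j)"
  have "coords w \<bullet> (coeff_matrix a *v coords w) = (\<Sum>i\<in>UNIV. \<Sum>j\<in>UNIV. ?t i j / 2 + ?t j i / 2)"
    by (simp add: inner_vec_def matrix_vector_mult_def coords_def coeff_matrix_def sum_distrib_left
        algebra_simps add_divide_distrib)
  also have "\<dots> = (\<Sum>i\<in>UNIV. \<Sum>j\<in>UNIV. ?t i j / 2) + (\<Sum>i\<in>UNIV. \<Sum>j\<in>UNIV. ?t j i / 2)"
    by (simp add: sum.distrib)
  also have "(\<Sum>i\<in>UNIV. \<Sum>j\<in>UNIV. ?t j i / 2) = (\<Sum>i\<in>UNIV. \<Sum>j\<in>UNIV. ?t i j / 2)"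
    by (rule sum.swap)
  also have "\<dots> + \<dots> = (\<Sum>i\<in>UNIV. \<Sum>j\<in>UNIV. ?t i j)"
    by (simp flip: sum_divide_distrib)
  also have "\<dots> = coeff_form a w"
    unfolding coeff_form_def
    by (subst sum_basis_index[of "\<lambda>b. \<Sum>j\<in>UNIV. (w \<bullet> b) * (w \<bullet> ?r j) * a b (?r j)"])
      (intro sum.cong refl sum_basis_index)
  finally show ?thesis by simp
qed

lemma assoc_bilinear_coeff_form:
  "assoc_bilinear (coeff_form a) v w = 2 * (coords w \<bullet> (coeff_matrix a *v coords v))"
proof -
  have "coords v \<bullet> (coeff_matrix a *v coords w) = coords w \<bullet> (coeff_matrix a *v coords v)"
    by (metis dot_lmul_matrix inner_commute transpose_coeff_matrix transpose_matrix_vector)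
  then show ?thesis
    by (simp add: assoc_bilinear_def coeff_form_eq_matrix linear_add[OF linear_coords]
        matrix_vector_right_distrib inner_add_left inner_add_right)
qed

text \<open>Second-order Hadamard expansion at a critical point; its coefficients at \<open>x0\<close> give
  the second derivative.\<close>

lemma hadamard_critical:
  fixes F :: "'e::euclidean_space \<Rightarrow> real"
  assumes "open S" and "convex S" and "x0 \<in> S" and F: "smooth_on S F"
    and crit: "\<And>v. frechet_derivative F (at x0) v = 0"
  obtains h where "\<And>b b'. smooth_on S (h b b')"
    and "\<And>x. x \<in> S \<Longrightarrow> F x = F x0 + coeff_form (\<lambda>b b'. h b b' x) (x - x0)"
    and "\<And>w. frechet_derivative (\<lambda>x. frechet_derivative F (at x) w) (at x0) w =
      2 * coeff_form (\<lambda>b b'. h b b' x0) w"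
proof -
  obtain g where g: "\<And>b. smooth_on S (g b)"
    and Fg: "\<And>x. x \<in> S \<Longrightarrow> F x = F x0 + (\<Sum>b\<in>Basis. ((x - x0) \<bullet> b) * g b x)"
    and g0: "\<And>b. g b x0 = frechet_derivative F (at x0) b"
    using hadamard[OF assms(1-3) F] by blast
  have "\<exists>h. (\<forall>b'. smooth_on S (h b')) \<and> (\<forall>x\<in>S. g b x = (\<Sum>b'\<in>Basis. ((x - x0) \<bullet> b') * h b' x)) \<and>
      (\<forall>b'. h b' x0 = frechet_derivative (g b) (at x0) b')" for b
  proof -
    obtain h where "\<And>b'. smooth_on S (h b')"
      and "\<And>x. x \<in> S \<Longrightarrow> g b x = g b x0 + (\<Sum>b'\<in>Basis. ((x - x0) \<bullet> b') * h b' x)"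
      and "\<And>b'. h b' x0 = frechet_derivative (g b) (at x0) b'"
      using hadamard[OF assms(1-3) g[of b]] by blast
    then show ?thesis using g0[of b] crit[of b] by (intro exI[of _ h]) simp
  qed
  then obtain h where h: "\<And>b b'. smooth_on S (h b b')"
    and gh: "\<And>b x. x \<in> S \<Longrightarrow> g b x = (\<Sum>b'\<in>Basis. ((x - x0) \<bullet> b') * h b b' x)"
    and h0: "\<And>b b'. h b b' x0 = frechet_derivative (g b) (at x0) b'"
    by metis
  have dg: "(g b has_derivative frechet_derivative (g b) (at x)) (at x)" if "x \<in> S" for b x
    using smooth_on_has_derivative[OF g that] .
  have "F x = F x0 + coeff_form (\<lambda>b b'. h b b' x) (x - x0)" if "x \<in> S" for x
    unfolding Fg[OF that] coeff_form_def by (simp add: gh[OF that] sum_distrib_left mult.assoc)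
  moreover have "frechet_derivative (\<lambda>x. frechet_derivative F (at x) w) (at x0) w =
      2 * coeff_form (\<lambda>b b'. h b b' x0) w" for w
  proof -
    let ?G = "\<lambda>x v. \<Sum>b\<in>Basis. ((x - x0) \<bullet> b) * frechet_derivative (g b) (at x) v + (v \<bullet> b) * g b x"
    have DF: "frechet_derivative F (at x) w = ?G x w" if x: "x \<in> S" for x
    proof -
      have "((\<lambda>x. F x0 + (\<Sum>b\<in>Basis. ((x - x0) \<bullet> b) * g b x)) has_derivative ?G x) (at x)"
        by (rule derivative_eq_intros dg[OF x] refl | simp add: algebra_simps)+
      then have "(F has_derivative ?G x) (at x)"
        by (rule has_derivative_transform_within_open[OF _ assms(1) x]) (simp add: Fg[symmetric])
      from fun_cong[OF frechet_derivative_at[OF this], of w] show ?thesis by simp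
    qed
    let ?D = "\<lambda>b x. frechet_derivative (g b) (at x) w"
    have dD: "(?D b has_derivative frechet_derivative (?D b) (at x0)) (at x0)" for b
      by (rule smooth_on_has_derivative[OF smooth_on_derivative[OF g] assms(3)])
    have "((\<lambda>x. ?G x w) has_derivative (\<lambda>v. \<Sum>b\<in>Basis. (v \<bullet> b) * ?D b x0 +
        (w \<bullet> b) * frechet_derivative (g b) (at x0) v)) (at x0)"
      by (rule derivative_eq_intros dg[OF assms(3)] dD refl | simp add: algebra_simps)+
    then have "((\<lambda>x. frechet_derivative F (at x) w) has_derivative (\<lambda>v. \<Sum>b\<in>Basis. (v \<bullet> b) * ?D b x0 +
        (w \<bullet> b) * frechet_derivative (g b) (at x0) v)) (at x0)"
      by (rule has_derivative_transform_within_open[OF _ assms(1,3)]) (simp add: DF)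
    from fun_cong[OF frechet_derivative_at[OF this], of w]
    have "frechet_derivative (\<lambda>x. frechet_derivative F (at x) w) (at x0) w =
        (\<Sum>b\<in>Basis. (w \<bullet> b) * ?D b x0 + (w \<bullet> b) * ?D b x0)"
      by simp
    also have "\<dots> = (\<Sum>b\<in>Basis. 2 * ((w \<bullet> b) * ?D b x0))"
      by simp
    also have "\<dots> = (\<Sum>b\<in>Basis. 2 * ((w \<bullet> b) * (\<Sum>b'\<in>Basis. (w \<bullet> b') * h b b' x0)))"
      using linear_basis_expansion[OF has_derivative_linear[OF dg[OF assms(3)]], of _ w]
      by (simp add: h0)
    also have "\<dots> = 2 * coeff_form (\<lambda>b b'. h b b' x0) w"
      by (simp add: coeff_form_def sum_distrib_left mult.assoc)
    finally show ?thesis .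
  qed
  ultimately show thesis using h that by blast
qed

text \<open>The Morse lemma around a point of a Euclidean space.\<close>

lemma morse_lemma_euclidean:
  fixes F :: "'e::euclidean_space \<Rightarrow> real" and h :: "'e \<Rightarrow> 'e \<Rightarrow> 'e \<Rightarrow> real"
  assumes "open S" and "x0 \<in> S" and h: "\<And>b b'. smooth_on S (h b b')"
    and F: "\<And>x. x \<in> S \<Longrightarrow> F x = F x0 + coeff_form (\<lambda>b b'. h b b' x) (x - x0)"
    and nondeg: "\<And>v. (\<And>w. assoc_bilinear (coeff_form (\<lambda>b b'. h b b' x0)) v w = 0) \<Longrightarrow> v = 0"
  obtains W T \<psi> \<Phi> where "open W" and "open T" and "0 \<in> W" and "T \<subseteq> S"
    and "\<psi> ` W \<subseteq> T" and "\<Phi> ` T \<subseteq> W" and "\<And>y. y \<in> W \<Longrightarrow> \<Phi> (\<psi> y) = y"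
    and "\<And>x. x \<in> T \<Longrightarrow> \<psi> (\<Phi> x) = x" and "smooth_on W \<psi>" and "smooth_on T \<Phi>"
    and "\<psi> 0 = x0" and "(\<psi> has_derivative (\<lambda>v. v)) (at 0)"
    and "\<And>y. y \<in> W \<Longrightarrow> F (\<psi> y) = F x0 + coeff_form (\<lambda>b b'. h b b' x0) y"
proof -
  let ?a = "\<lambda>x b b'. h b b' x"
  define \<kappa> :: "'e \<Rightarrow> real ^ 'e basis_index" where "\<kappa> = (\<lambda>x. coords (x - x0))"
  define \<mu> :: "real ^ 'e basis_index \<Rightarrow> 'e" where "\<mu> = (\<lambda>z. x0 + of_coords z)"
  have \<mu>\<kappa>: "\<mu> (\<kappa> x) = x" "\<kappa> (\<mu> z) = z" for x z by (simp_all add: \<mu>_def \<kappa>_def)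
  have bl: "bounded_linear (coords :: 'e \<Rightarrow> _)" "bounded_linear (of_coords :: _ \<Rightarrow> 'e)"
    using linear_coords linear_of_coords by (simp_all add: linear_conv_bounded_linear)
  have \<kappa>0: "\<kappa> = (\<lambda>x. coords (x + - x0))" by (simp add: \<kappa>_def)
  have \<kappa>: "smooth_on X \<kappa>" if "open X" for X
    unfolding \<kappa>0 using that
    by (intro smooth_on_bounded_linear[OF bl(1)] smooth_on_add smooth_on_ident smooth_on_const)
  have \<mu>: "smooth_on X \<mu>" if "open X" for X
    unfolding \<mu>_def using that
    by (intro smooth_on_bounded_linear[OF bl(2)] smooth_on_add smooth_on_ident smooth_on_const)
  have open\<mu>: "open (\<mu> -` X)" if "open X" for X
    using continuous_open_preimage[OF smooth_on_continuous[OF \<mu>[OF open_UNIV]] open_UNIV that] by simp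
  have open\<kappa>: "open (\<kappa> -` X)" if "open X" for X
    using continuous_open_preimage[OF smooth_on_continuous[OF \<kappa>[OF open_UNIV]] open_UNIV that] by simp
  have opencoords: "open ((coords :: 'e \<Rightarrow> _) -` X)" if "open X" for X
    using continuous_open_preimage[OF linear_continuous_on[OF bl(1)] open_UNIV that] by simp
  define S' where "S' = \<mu> -` S"
  have S': "open S'" "0 \<in> S'"
    using open\<mu>[OF assms(1)] assms(2) by (simp_all add: S'_def \<mu>_def linear_0[OF linear_of_coords])
  define H where "H = (\<lambda>z. coeff_matrix (?a (\<mu> z)))"
  have \<mu>0: "\<mu> 0 = x0" by (simp add: \<mu>_def linear_0[OF linear_of_coords])
  have hl: "smooth_on S' (\<lambda>z. h b b' (\<mu> z))" for b b'
    by (rule smooth_on_compose[OF S'(1) assms(1) \<mu>[OF S'(1)] h]) (auto simp: S'_def)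
  have "smooth_on S' (\<lambda>z. (1/2) * (h b b' (\<mu> z) + h b' b (\<mu> z)))" for b b'
    by (intro smooth_on_mult smooth_on_add smooth_on_const S' hl)
  then have H: "smooth_on S' H"
    unfolding H_def coeff_matrix_def by (intro smooth_on_vec S') simp
  have inv: "invertible (H 0)"
  proof -
    have "z = 0" if z: "H 0 *v z = 0" for z
    proof -
      have "assoc_bilinear (coeff_form (?a x0)) (of_coords z) w = 0" for w
        using z by (simp add: assoc_bilinear_coeff_form H_def \<mu>0)
      then have "of_coords z = 0" by (rule nondeg)
      then show ?thesis using coords_of_coords[of z] by (simp add: linear_0[OF linear_coords])
    qed
    then show ?thesis by (simp add: invertible_left_inverse matrix_left_invertible_ker)
  qed
  obtain W T \<psi> \<Phi> where *: "open W" "open T" "0 \<in> W" "T \<subseteq> S'"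
    "\<psi> ` W \<subseteq> T" "\<Phi> ` T \<subseteq> W" "\<And>y. y \<in> W \<Longrightarrow> \<Phi> (\<psi> y) = y" "\<And>x. x \<in> T \<Longrightarrow> \<psi> (\<Phi> x) = x"
    "smooth_on W \<psi>" "smooth_on T \<Phi>" "\<psi> 0 = 0" "(\<psi> has_derivative (\<lambda>v. v)) (at 0)"
    "\<And>y. y \<in> W \<Longrightarrow> \<psi> y \<bullet> (H (\<psi> y) *v \<psi> y) = y \<bullet> (H 0 *v y)"
    by (rule morse_lemma_matrix[OF S' H _ inv]) (simp add: H_def transpose_coeff_matrix, blast)
  have c0: "coords (0 :: 'e) = 0" by (rule linear_0[OF linear_coords])
  define W' where "W' = (coords :: 'e \<Rightarrow> _) -` W"
  define T' where "T' = \<kappa> -` T"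
  have oW: "open W'" and oT: "open T'"
    using opencoords[OF *(1)] open\<kappa>[OF *(2)] by (simp_all add: W'_def T'_def)
  show thesis
  proof (rule that[of W' T' "\<lambda>y. \<mu> (\<psi> (coords y))" "\<lambda>x. of_coords (\<Phi> (\<kappa> x))"])
    show "T' \<subseteq> S" using *(4) \<mu>\<kappa>(1) by (force simp: T'_def S'_def)
    show "smooth_on W' (\<lambda>y. \<mu> (\<psi> (coords y)))"
      by (intro smooth_on_compose[OF oW open_UNIV _ \<mu>[OF open_UNIV]]
          smooth_on_compose[OF oW *(1) smooth_on_bounded_linear[OF bl(1) oW smooth_on_ident[OF oW]] *(9)])
        (auto simp: W'_def)
    show "smooth_on T' (\<lambda>x. of_coords (\<Phi> (\<kappa> x)))"
      by (intro smooth_on_bounded_linear[OF bl(2) oT] smooth_on_compose[OF oT *(2) \<kappa>[OF oT] *(10)])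
        (auto simp: T'_def)
    have "((\<lambda>y. \<psi> (coords y)) has_derivative (\<lambda>v. coords v)) (at (0 :: 'e))"
      by (rule has_derivative_compose[where g' = "\<lambda>v. v"]) (simp_all add: c0 *(12)
          bounded_linear_imp_has_derivative[OF bl(1)])
    then have "((\<lambda>y. x0 + of_coords (\<psi> (coords y))) has_derivative (\<lambda>v. 0 + of_coords (coords v))) (at (0 :: 'e))"
      by (intro has_derivative_add has_derivative_const bounded_linear.has_derivative[OF bl(2)])
    then show "((\<lambda>y. \<mu> (\<psi> (coords y))) has_derivative (\<lambda>v. v)) (at 0)"
      by (simp add: \<mu>_def)
    show "F (\<mu> (\<psi> (coords y))) = F x0 + coeff_form (?a x0) y" if "y \<in> W'" for y
    proof -
      let ?z = "\<psi> (coords y)"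
      have y: "coords y \<in> W" using that by (simp add: W'_def)
      then have "?z \<in> S'" using *(4,5) by blast
      then have "F (\<mu> ?z) = F x0 + coeff_form (?a (\<mu> ?z)) (\<mu> ?z - x0)"
        using F by (simp add: S'_def)
      also have "coeff_form (?a (\<mu> ?z)) (\<mu> ?z - x0) = ?z \<bullet> (H ?z *v ?z)"
        by (simp add: coeff_form_eq_matrix H_def \<mu>_def)
      also have "\<dots> = coeff_form (?a x0) y"
        using *(13)[OF y] by (simp add: coeff_form_eq_matrix H_def \<mu>0)
      finally show ?thesis .
    qed
  qed (use * oW oT in \<open>auto simp: W'_def T'_def \<mu>\<kappa> \<mu>0 c0\<close>)
qed

section \<open>Functions and tangent vectors in a chart\<close>

lemma smooth_map_on_subset:
  assumes "smooth_map_on V A B S F" and "openin V S'" and "S' \<subseteq> S"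
  shows "smooth_map_on V A B S' F"
  unfolding smooth_map_on_def
proof
  fix x assume x: "x \<in> S'"
  then have "x \<in> S" using assms(3) by blast
  then obtain U \<phi> U' \<phi>' T where T: "(U, \<phi>) \<in> A" "(U', \<phi>') \<in> B" "openin V T" "x \<in> T"
    "T \<subseteq> S \<inter> U" "F ` T \<subseteq> U'" "smooth_on (\<phi> ` T) (\<phi>' \<circ> F \<circ> inv_into U \<phi>)"
    using assms(1) unfolding smooth_map_on_def by meson
  show "\<exists>U \<phi> U' \<phi>' T. (U, \<phi>) \<in> A \<and> (U', \<phi>') \<in> B \<and> openin V T \<and> x \<in> T \<and>
      T \<subseteq> S' \<inter> U \<and> F ` T \<subseteq> U' \<and> smooth_on (\<phi> ` T) (\<phi>' \<circ> F \<circ> inv_into U \<phi>)"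
  proof (intro exI conjI)
    show "smooth_on (\<phi> ` (T \<inter> S')) (\<phi>' \<circ> F \<circ> inv_into U \<phi>)"
      by (rule smooth_on_subset[OF T(7)]) blast
  qed (use T x assms(2) in auto)
qed

text \<open>A fixed chart \<open>(U, \<phi>)\<close> of a smooth atlas.\<close>

locale chart_of_atlas =
  fixes V :: "'a topology" and A :: "('a, 'e::euclidean_space) atlas" and U :: "'a set" and \<phi> :: "'a \<Rightarrow> 'e"
  assumes atlas: "smooth_atlas V A" and chart_in: "(U, \<phi>) \<in> A"
begin

text \<open>The inverse of the chart; its values outside \<open>\<phi> ` U\<close> are irrelevant.\<close>

definition chart_inv :: "'e \<Rightarrow> 'a" where "chart_inv = inv_into U \<phi>"

lemma chart_props: "openin V U" "open (\<phi> ` U)"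
    "homeomorphic_map (subtopology V U) (top_of_set (\<phi> ` U)) \<phi>"
  using atlas chart_in by (auto simp: smooth_atlas_def chart_def)

lemma U_sub: "U \<subseteq> topspace V"
  using chart_props(1) by (rule openin_subset)

lemma inj_chart: "inj_on \<phi> U"
  using homeomorphic_imp_injective_map[OF chart_props(3)] U_sub by (simp add: Int_absorb1)

lemma chart_inv_chart [simp]: "p \<in> U \<Longrightarrow> chart_inv (\<phi> p) = p"
  by (simp add: chart_inv_def inj_chart)

lemma chart_chart_inv [simp]: "x \<in> \<phi> ` U \<Longrightarrow> \<phi> (chart_inv x) = x"
  by (simp add: chart_inv_def f_inv_into_f)

lemma chart_inv_in [simp]: "x \<in> \<phi> ` U \<Longrightarrow> chart_inv x \<in> U"
  by (simp add: chart_inv_def inv_into_into)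

lemma open_chart_image: "openin V S \<Longrightarrow> S \<subseteq> U \<Longrightarrow> open (\<phi> ` S)"
  using homeomorphic_map_openness_eq[OF chart_props(3), of S] chart_props(1,2)
  by (auto simp: openin_open_subtopology intro: openin_open_trans)

lemma openin_chart_inv: 
  assumes "open T" and "T \<subseteq> \<phi> ` U" shows "openin V (chart_inv ` T)"
proof -
  have "\<phi> ` chart_inv ` T = T" "chart_inv ` T \<subseteq> U"
    using assms(2) by (force simp: image_iff)+
  then show ?thesis
    using homeomorphic_map_openness_eq[OF chart_props(3), of "chart_inv ` T"] chart_props(1) assms U_sub
    by (auto simp: openin_open_subtopology intro: open_subset)
qed

text \<open>By definition a smooth function is smooth in some chart around each point; the transition
  maps carry this over to the given chart.\<close>

lemma smooth_fun_on_chart: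
  assumes S: "openin V S" and g: "smooth_fun_on V A S g"
  shows "smooth_on (\<phi> ` (S \<inter> U)) (\<lambda>x. g (chart_inv x))"
proof (rule smooth_on_local)
  fix x assume "x \<in> \<phi> ` (S \<inter> U)"
  then obtain p where p: "p \<in> S" "p \<in> U" "x = \<phi> p" by auto
  then obtain U1 \<phi>1 T where U1: "(U1, \<phi>1) \<in> A" and T: "openin V T" "p \<in> T" "T \<subseteq> S \<inter> U1"
    and sm: "smooth_on (\<phi>1 ` T) (id \<circ> g \<circ> inv_into U1 \<phi>1)"
    using g unfolding smooth_map_on_def by fast
  interpret c1: chart_of_atlas V A U1 \<phi>1 using atlas U1 by unfold_locales
  have oT: "openin V (T \<inter> U)" "T \<inter> U \<subseteq> U" using T(1) chart_props(1) by auto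
  have o1: "open (\<phi> ` (T \<inter> U))" by (rule open_chart_image[OF oT])
  have o2: "open (\<phi>1 ` T)" using c1.open_chart_image[OF T(1)] T(3) by blast
  have "smooth_on (\<phi> ` (U \<inter> U1)) (\<phi>1 \<circ> inv_into U \<phi>)"
    using atlas chart_in U1 unfolding smooth_atlas_def by fast
  then have tr: "smooth_on (\<phi> ` (T \<inter> U)) (\<lambda>y. \<phi>1 (chart_inv y))"
    unfolding comp_def chart_inv_def by (rule smooth_on_subset) (use T(3) in blast)
  have "smooth_on (\<phi> ` (T \<inter> U)) (\<lambda>y. (id \<circ> g \<circ> inv_into U1 \<phi>1) (\<phi>1 (chart_inv y)))"
    by (rule smooth_on_compose[OF o1 o2 tr sm]) auto
  then have "smooth_on (\<phi> ` (T \<inter> U)) (\<lambda>y. g (chart_inv y))"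
  proof (rule smooth_on_cong[OF o1, rotated])
    fix y assume "y \<in> \<phi> ` (T \<inter> U)"
    then have "chart_inv y \<in> U1" using T(3) by auto
    then show "(id \<circ> g \<circ> inv_into U1 \<phi>1) (\<phi>1 (chart_inv y)) = g (chart_inv y)"
      using c1.chart_inv_chart by (simp add: c1.chart_inv_def)
  qed
  then show "\<exists>T. open T \<and> x \<in> T \<and> smooth_on T (\<lambda>x. g (chart_inv x))"
    using o1 p T(2) by blast
qed

lemma smooth_fun_onI:
  assumes "openin V S" and "S \<subseteq> U" and "smooth_on (\<phi> ` S) (\<lambda>x. g (chart_inv x))"
  shows "smooth_fun_on V A S g"
  unfolding smooth_map_on_def
proof (intro ballI exI conjI)
  show "smooth_on (\<phi> ` S) (id \<circ> g \<circ> inv_into U \<phi>)"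
    using assms(3) by (simp add: comp_def chart_inv_def)
qed (use assms chart_in in auto)

lemma smooth_fun_near_iff:
  assumes "p \<in> U"
  shows "smooth_fun_near V A p g \<longleftrightarrow>
    (\<exists>T. open T \<and> \<phi> p \<in> T \<and> T \<subseteq> \<phi> ` U \<and> smooth_on T (\<lambda>x. g (chart_inv x)))"
proof
  assume "smooth_fun_near V A p g"
  then obtain S where S: "openin V S" "p \<in> S" "smooth_fun_on V A S g"
    by (auto simp: smooth_fun_near_def)
  have "open (\<phi> ` (S \<inter> U))" using S(1) chart_props(1) by (intro open_chart_image) auto
  then show "\<exists>T. open T \<and> \<phi> p \<in> T \<and> T \<subseteq> \<phi> ` U \<and> smooth_on T (\<lambda>x. g (chart_inv x))"
    using smooth_fun_on_chart[OF S(1,3)] S(2) assms by (intro exI[of _ "\<phi> ` (S \<inter> U)"]) auto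
next
  assume "\<exists>T. open T \<and> \<phi> p \<in> T \<and> T \<subseteq> \<phi> ` U \<and> smooth_on T (\<lambda>x. g (chart_inv x))"
  then obtain T where T: "open T" "\<phi> p \<in> T" "T \<subseteq> \<phi> ` U" "smooth_on T (\<lambda>x. g (chart_inv x))" by blast
  have *: "\<phi> ` chart_inv ` T = T" "chart_inv ` T \<subseteq> U" using T(3) by (force simp: image_iff)+
  have "p \<in> chart_inv ` T" using T(2) assms by (force simp: image_iff)
  then show "smooth_fun_near V A p g"
    unfolding smooth_fun_near_def
    using smooth_fun_onI[OF openin_chart_inv[OF T(1,3)] *(2)] openin_chart_inv[OF T(1,3)] * T(4) by auto
qed

lemma near_cases:
  assumes "p \<in> U" and "smooth_fun_near V A p g"
  obtains T where "open T" and "\<phi> p \<in> T" and "T \<subseteq> \<phi> ` U" and "smooth_on T (\<lambda>x. g (chart_inv x))"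
  using assms(2) unfolding smooth_fun_near_iff[OF assms(1)] by auto

lemma near_has_derivative:
  assumes "p \<in> U" and "smooth_fun_near V A p g"
  shows "((\<lambda>x. g (chart_inv x)) has_derivative frechet_derivative (\<lambda>x. g (chart_inv x)) (at (\<phi> p))) (at (\<phi> p))"
  using near_cases[OF assms] smooth_on_has_derivative by metis

lemma near_const:
  assumes "p \<in> U" shows "smooth_fun_near V A p (\<lambda>x. r)"
  unfolding smooth_fun_near_iff[OF assms]
  by (intro exI[of _ "\<phi> ` U"] conjI chart_props(2) smooth_on_const) (use assms in auto)

lemma near_add:
  assumes "p \<in> U" and "smooth_fun_near V A p f" and "smooth_fun_near V A p g"
  shows "smooth_fun_near V A p (\<lambda>x. f x + g x)"
proof -
  obtain S where S: "open S" "\<phi> p \<in> S" "S \<subseteq> \<phi> ` U" "smooth_on S (\<lambda>x. f (chart_inv x))"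
    using near_cases[OF assms(1,2)] .
  obtain T where T: "open T" "\<phi> p \<in> T" "T \<subseteq> \<phi> ` U" "smooth_on T (\<lambda>x. g (chart_inv x))"
    using near_cases[OF assms(1,3)] .
  have "smooth_on (S \<inter> T) (\<lambda>x. f (chart_inv x) + g (chart_inv x))"
    by (intro smooth_on_add open_Int S(1) T(1) smooth_on_subset[OF S(4)] smooth_on_subset[OF T(4)]) auto
  then show ?thesis
    unfolding smooth_fun_near_iff[OF assms(1)] using S T by (intro exI[of _ "S \<inter> T"]) auto
qed

lemma near_mult:
  assumes "p \<in> U" and "smooth_fun_near V A p f" and "smooth_fun_near V A p g"
  shows "smooth_fun_near V A p (\<lambda>x. f x * g x)"
proof -
  obtain S where S: "open S" "\<phi> p \<in> S" "S \<subseteq> \<phi> ` U" "smooth_on S (\<lambda>x. f (chart_inv x))"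
    using near_cases[OF assms(1,2)] .
  obtain T where T: "open T" "\<phi> p \<in> T" "T \<subseteq> \<phi> ` U" "smooth_on T (\<lambda>x. g (chart_inv x))"
    using near_cases[OF assms(1,3)] .
  have "smooth_on (S \<inter> T) (\<lambda>x. f (chart_inv x) * g (chart_inv x))"
    by (intro smooth_on_mult open_Int S(1) T(1) smooth_on_subset[OF S(4)] smooth_on_subset[OF T(4)]) auto
  then show ?thesis
    unfolding smooth_fun_near_iff[OF assms(1)] using S T by (intro exI[of _ "S \<inter> T"]) auto
qed

lemma near_sum:
  assumes "p \<in> U" and "\<And>i. i \<in> I \<Longrightarrow> smooth_fun_near V A p (f i)"
  shows "smooth_fun_near V A p (\<lambda>x. \<Sum>i\<in>I. f i x)"
  using assms(2)
  by (induction I rule: infinite_finite_induct) (simp_all add: near_const near_add assms(1))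

lemma near_chart_fun:
  assumes "p \<in> U" and "open T" and "\<phi> p \<in> T" and "smooth_on T G"
  shows "smooth_fun_near V A p (\<lambda>x. G (\<phi> x))"
  unfolding smooth_fun_near_iff[OF assms(1)]
proof (intro exI conjI)
  show o: "open (T \<inter> \<phi> ` U)" using assms(2) chart_props(2) by blast
  show "smooth_on (T \<inter> \<phi> ` U) (\<lambda>x. G (\<phi> (chart_inv x)))"
    by (rule smooth_on_cong[OF o _ smooth_on_subset[OF assms(4)]]) auto
qed (use assms in auto)

text \<open>The coordinate function in the direction of \<open>b\<close>. It need not be smooth outside
  \<open>U\<close>, but only its germs at points of \<open>U\<close> matter.\<close>

definition coord :: "'e \<Rightarrow> 'a \<Rightarrow> real" where "coord b = (\<lambda>p. \<phi> p \<bullet> b)"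

lemma near_coord: "p \<in> U \<Longrightarrow> smooth_fun_near V A p (coord b)"
  unfolding coord_def
  by (rule near_chart_fun[where G = "\<lambda>x. x \<bullet> b", OF _ open_UNIV UNIV_I
        smooth_on_inner_left[OF open_UNIV smooth_on_ident[OF open_UNIV]]])

lemma smooth_coord:
  assumes "openin V S" and "S \<subseteq> U" shows "smooth_fun_on V A S (coord b)"
proof (rule smooth_fun_onI[OF assms])
  have o: "open (\<phi> ` S)" by (rule open_chart_image[OF assms])
  have "smooth_on (\<phi> ` S) (\<lambda>x. x \<bullet> b)" by (intro smooth_on_inner_left smooth_on_ident o)
  then show "smooth_on (\<phi> ` S) (\<lambda>x. coord b (chart_inv x))"
    by (rule smooth_on_cong[OF o, rotated]) (use assms(2) in \<open>auto simp: coord_def\<close>)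
qed

text \<open>The tangent vector at \<open>p\<close> with coordinate vector \<open>w\<close>, and the coordinate vector of a
  tangent vector.\<close>

definition tvec_of :: "'a \<Rightarrow> 'e \<Rightarrow> 'a tvec" where
  "tvec_of p w = (\<lambda>g. if smooth_fun_near V A p g
     then frechet_derivative (\<lambda>x. g (chart_inv x)) (at (\<phi> p)) w else 0)"

definition tcoords :: "'a tvec \<Rightarrow> 'e" where
  "tcoords v = (\<Sum>b\<in>Basis. v (coord b) *\<^sub>R b)"

lemma linear_tcoords: "linear tcoords"
  by (intro linearI)
    (simp_all add: tcoords_def scaleR_add_left sum.distrib scaleR_sum_right scaleR_fun_def)

lemma linear_tvec_of: assumes "p \<in> U" shows "linear (tvec_of p)"
proof -
  have *: "linear (frechet_derivative (\<lambda>x. g (chart_inv x)) (at (\<phi> p)))" if "smooth_fun_near V A p g" for g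
    by (rule has_derivative_linear[OF near_has_derivative[OF assms that]])
  show ?thesis
    by (intro linearI)
      (auto simp: tvec_of_def fun_eq_iff scaleR_fun_def linear_add[OF *] linear_scale[OF *])
qed

lemma tvec_of_tangent: assumes p: "p \<in> U" shows "tvec_of p w \<in> tangent_space V A p"
proof -
  let ?D = "\<lambda>g. frechet_derivative (\<lambda>x. g (chart_inv x)) (at (\<phi> p))"
  have D: "((\<lambda>x. g (chart_inv x)) has_derivative ?D g) (at (\<phi> p))" if "smooth_fun_near V A p g" for g
    by (rule near_has_derivative[OF p that])
  have 1: "?D (\<lambda>x. f x + g x) w = ?D f w + ?D g w"
    if "smooth_fun_near V A p f" "smooth_fun_near V A p g" for f g
    using fun_cong[OF frechet_derivative_at[OF has_derivative_add[OF D[OF that(1)] D[OF that(2)]]], of w]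
    by simp
  have 2: "?D (\<lambda>x. f x * g x) w = ?D f w * g p + f p * ?D g w"
    if "smooth_fun_near V A p f" "smooth_fun_near V A p g" for f g
    using fun_cong[OF frechet_derivative_at[OF has_derivative_mult[OF D[OF that(1)] D[OF that(2)]]], of w] p
    by simp
  have 3: "smooth_fun_near V A p g \<and> ?D f w = ?D g w"
    if f: "smooth_fun_near V A p f" and S: "openin V S" "p \<in> S" "\<forall>x\<in>S. f x = g x" for f g S
  proof -
    obtain T where T: "open T" "\<phi> p \<in> T" "T \<subseteq> \<phi> ` U" "smooth_on T (\<lambda>x. f (chart_inv x))"
      using near_cases[OF p f] .
    let ?T = "T \<inter> \<phi> ` (S \<inter> U)"
    have o: "open ?T" using T(1) S(1) chart_props(1) by (intro open_Int open_chart_image) auto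
    have in_T: "\<phi> p \<in> ?T" using T(2) S(2) p by blast
    have eq: "f (chart_inv x) = g (chart_inv x)" if "x \<in> ?T" for x
      using S(3) that by auto
    have "smooth_on ?T (\<lambda>x. g (chart_inv x))"
      by (rule smooth_on_cong[OF o _ smooth_on_subset[OF T(4)]]) (use eq in auto)
    then have "smooth_fun_near V A p g"
      unfolding smooth_fun_near_iff[OF p] using o in_T T(3) by blast
    moreover have "?D f = ?D g"
      using frechet_derivative_at[OF has_derivative_transform_within_open[OF D[OF f] o in_T eq]] by simp
    ultimately show ?thesis by simp
  qed
  show ?thesis
    unfolding tangent_space_def
  proof (intro CollectI conjI allI impI; (elim conjE exE)?)
    fix f g assume n: "smooth_fun_near V A p f" "smooth_fun_near V A p g"
    show "tvec_of p w (\<lambda>x. f x + g x) = tvec_of p w f + tvec_of p w g"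
      using n near_add[OF p n] 1[OF n] by (simp add: tvec_of_def)
    show "tvec_of p w (\<lambda>x. f x * g x) = tvec_of p w f * g p + f p * tvec_of p w g"
      using n near_mult[OF p n] 2[OF n] by (simp add: tvec_of_def)
  next
    fix r f assume n: "smooth_fun_near V A p f"
    show "tvec_of p w (\<lambda>x. r * f x) = r * tvec_of p w f"
      using n near_mult[OF p near_const[OF p] n] 2[OF near_const[OF p, of r] n] by (simp add: tvec_of_def)
  next
    fix f g S assume "smooth_fun_near V A p f" "openin V S" "p \<in> S" "\<forall>x\<in>S. f x = g x"
    then show "tvec_of p w f = tvec_of p w g" using 3 by (simp add: tvec_of_def)
  qed (simp add: tvec_of_def)
qed

context
  fixes p v assumes p: "p \<in> U" and v: "v \<in> tangent_space V A p"
begin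

lemma tangent_add: "v (\<lambda>x. f x + g x) = v f + v g"
  and tangent_mult: "v (\<lambda>x. f x * g x) = v f * g p + f p * v g"
  if "smooth_fun_near V A p f" and "smooth_fun_near V A p g"
  using v that by (simp_all add: tangent_space_def)

lemma tangent_germ:
  assumes "smooth_fun_near V A p f" and "openin V S" and "p \<in> S" and "\<And>x. x \<in> S \<Longrightarrow> f x = g x"
  shows "v f = v g"
proof -
  have "smooth_fun_near V A p f \<and> (\<exists>S. openin V S \<and> p \<in> S \<and> (\<forall>x\<in>S. f x = g x)) \<longrightarrow> v f = v g"
    using v by (simp add: tangent_space_def)
  then show ?thesis using assms by blast
qed

lemma tangent_nonsmooth: "\<not> smooth_fun_near V A p f \<Longrightarrow> v f = 0"
  using v by (simp add: tangent_space_def)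

lemma tangent_const: "v (\<lambda>x. r) = 0"
proof -
  have "v (\<lambda>x. 1) = 0" using tangent_mult[OF near_const[OF p, of 1] near_const[OF p, of 1]] by simp
  then show ?thesis
    using tangent_mult[OF near_const[OF p, of r] near_const[OF p, of 1]]
      v near_const[OF p, of 1] unfolding tangent_space_def by force
qed

lemma tangent_sum:
  assumes "\<And>i. i \<in> I \<Longrightarrow> smooth_fun_near V A p (f i)"
  shows "v (\<lambda>x. \<Sum>i\<in>I. f i x) = (\<Sum>i\<in>I. v (f i))"
  using assms
  by (induction I rule: infinite_finite_induct)
    (simp_all add: tangent_const tangent_add near_sum[OF p])

text \<open>By Hadamard's lemma a derivation is determined by its values on the coordinates.\<close>

lemma tangent_eq_derivative:
  assumes g: "smooth_fun_near V A p g"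
  shows "v g = frechet_derivative (\<lambda>x. g (chart_inv x)) (at (\<phi> p)) (tcoords v)"
proof -
  let ?g = "\<lambda>x. g (chart_inv x)" and ?x = "\<phi> p"
  obtain T where T: "open T" "?x \<in> T" "T \<subseteq> \<phi> ` U" "smooth_on T ?g"
    using near_cases[OF p g] .
  then obtain r where r: "r > 0" "ball ?x r \<subseteq> T" using open_contains_ball by blast
  let ?B = "ball ?x r"
  obtain G where G: "\<And>b. smooth_on ?B (G b)"
    and gG: "\<And>x. x \<in> ?B \<Longrightarrow> ?g x = ?g ?x + (\<Sum>b\<in>Basis. ((x - ?x) \<bullet> b) * G b x)"
    and G0: "\<And>b. G b ?x = frechet_derivative ?g (at ?x) b"
    using hadamard[OF open_ball convex_ball _ smooth_on_subset[OF T(4) r(2)], of ?x] r(1) by auto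
  let ?c = "\<lambda>b y. coord b y + - (?x \<bullet> b)" and ?G = "\<lambda>b y. G b (\<phi> y)"
  have nG: "smooth_fun_near V A p (?G b)" for b
    by (rule near_chart_fun[OF p open_ball _ G]) (use r in simp)
  have nc: "smooth_fun_near V A p (?c b)" for b
    by (intro near_add near_coord near_const p)
  have vc: "v (?c b) = v (coord b)" for b
    using tangent_add[OF near_coord[OF p, of b] near_const[OF p, of "- (?x \<bullet> b)"]] tangent_const by simp
  let ?S = "chart_inv ` ?B"
  have "chart_inv ?x \<in> ?S" using r(1) by (intro imageI) simp
  then have S: "openin V ?S" "p \<in> ?S"
    using openin_chart_inv[OF open_ball, of ?x r] r(2) T(3) p by auto
  have "v g = v (\<lambda>y. g p + (\<Sum>b\<in>Basis. ?c b y * ?G b y))"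
  proof (rule tangent_germ[OF g S])
    fix y assume "y \<in> ?S"
    then obtain x where x: "x \<in> ?B" "y = chart_inv x" by blast
    then have "x \<in> \<phi> ` U" using r(2) T(3) by blast
    then have "\<phi> y = x" using x(2) by simp
    then show "g y = g p + (\<Sum>b\<in>Basis. ?c b y * ?G b y)"
      using gG[OF x(1)] x(2) p by (simp add: coord_def inner_diff_left)
  qed
  also have "\<dots> = (\<Sum>b\<in>Basis. v (\<lambda>y. ?c b y * ?G b y))"
  proof -
    have nS: "smooth_fun_near V A p (\<lambda>y. \<Sum>b\<in>Basis. ?c b y * ?G b y)"
      by (intro near_sum near_mult p nc nG)
    have "v (\<lambda>y. g p + (\<Sum>b\<in>Basis. ?c b y * ?G b y)) = v (\<lambda>y. \<Sum>b\<in>Basis. ?c b y * ?G b y)"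
      using tangent_add[OF near_const[OF p] nS] tangent_const[of "g p"] by simp
    also have "\<dots> = (\<Sum>b\<in>Basis. v (\<lambda>y. ?c b y * ?G b y))"
      by (rule tangent_sum) (intro near_mult p nc nG)
    finally show ?thesis .
  qed
  also have "\<dots> = (\<Sum>b\<in>Basis. v (coord b) *\<^sub>R frechet_derivative ?g (at ?x) b)"
  proof -
    have "?c b p = 0" for b by (simp add: coord_def)
    then have "v (\<lambda>y. ?c b y * ?G b y) = v (coord b) *\<^sub>R frechet_derivative ?g (at ?x) b" for b
      unfolding tangent_mult[OF nc[of b] nG[of b]] by (simp only: vc G0) simp
    then show ?thesis by simp
  qed
  also have "\<dots> = frechet_derivative ?g (at ?x) (tcoords v)"
    using has_derivative_linear[OF near_has_derivative[OF p g]]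
    by (simp add: tcoords_def linear_sum linear_scale)
  finally show ?thesis .
qed

lemma tvec_of_tcoords: "tvec_of p (tcoords v) = v"
  using tangent_eq_derivative tangent_nonsmooth by (auto simp: tvec_of_def fun_eq_iff)

end

lemma tcoords_tvec_of: assumes p: "p \<in> U" shows "tcoords (tvec_of p w) = w"
proof -
  have "frechet_derivative (\<lambda>x. coord b (chart_inv x)) (at (\<phi> p)) w = w \<bullet> b" for b
  proof -
    have "((\<lambda>x. x \<bullet> b) has_derivative (\<lambda>w. w \<bullet> b)) (at (\<phi> p))"
      by (auto intro!: derivative_eq_intros)
    then have "((\<lambda>x. coord b (chart_inv x)) has_derivative (\<lambda>w. w \<bullet> b)) (at (\<phi> p))"
      by (rule has_derivative_transform_within_open[OF _ chart_props(2)]) (use p in \<open>auto simp: coord_def\<close>)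
    from fun_cong[OF frechet_derivative_at[OF this], of w] show ?thesis by simp
  qed
  then show ?thesis
    by (simp add: tcoords_def tvec_of_def near_coord[OF p] euclidean_representation)
qed

lemma bij_tcoords: assumes "p \<in> U" shows "bij_betw tcoords (tangent_space V A p) UNIV"
  by (rule bij_betw_byWitness[where f' = "tvec_of p"])
    (auto simp: tvec_of_tcoords[OF assms] tcoords_tvec_of[OF assms] tvec_of_tangent[OF assms])

lemma subspace_tangent_space: assumes "p \<in> U" shows "subspace (tangent_space V A p)"
proof -
  have "tangent_space V A p = range (tvec_of p)"
    using tvec_of_tcoords[OF assms] tvec_of_tangent[OF assms] by (metis image_subsetI rangeI subsetI subset_antisym)
  then show ?thesis using linear_subspace_image[OF linear_tvec_of[OF assms] subspace_UNIV] by simp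
qed

text \<open>A field with constant coordinates extends any given tangent vector.\<close>

lemma vector_field_tvec_of: "vector_field_on V A U (\<lambda>p. tvec_of p w)"
  unfolding vector_field_on_def
proof (intro conjI ballI allI impI; (elim conjE)?)
  fix S f assume S: "openin V S" "S \<subseteq> U" and f: "smooth_fun_on V A S f"
  have o: "open (\<phi> ` S)" by (rule open_chart_image[OF S])
  have "smooth_on (\<phi> ` S) (\<lambda>x. f (chart_inv x))"
    using smooth_fun_on_chart[OF S(1) f] S(2) by (simp add: Int_absorb2)
  then have "smooth_on (\<phi> ` S) (\<lambda>x. frechet_derivative (\<lambda>x. f (chart_inv x)) (at x) w)"
    by (rule smooth_on_derivative)
  then have "smooth_on (\<phi> ` S) (\<lambda>x. tvec_of (chart_inv x) w f)"
  proof (rule smooth_on_cong[OF o, rotated])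
    fix x assume "x \<in> \<phi> ` S"
    then obtain p where p: "p \<in> S" "p \<in> U" "x = \<phi> p" using S(2) by blast
    then have "smooth_fun_near V A p f"
      unfolding smooth_fun_near_def using S(1) f by blast
    then show "frechet_derivative (\<lambda>x. f (chart_inv x)) (at x) w = tvec_of (chart_inv x) w f"
      using p by (simp add: tvec_of_def)
  qed
  then show "smooth_fun_on V A S (\<lambda>p. tvec_of p w f)" by (rule smooth_fun_onI[OF S])
qed (rule tvec_of_tangent)

text \<open>In coordinates \<open>X f\<close> is the sum of the products of \<open>X (coord b)\<close> with the partial derivatives
  of \<open>f\<close>. These vanish at the critical point, so the derivatives of the coefficients of \<open>X\<close> do not
  contribute to \<open>X (X f)\<close> there.\<close>

lemma second_derivative_field:
  assumes f: "\<And>S. openin V S \<Longrightarrow> smooth_fun_on V A S f" and c: "c \<in> U"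
    and crit: "\<forall>v\<in>tangent_space V A c. v f = 0"
    and W: "openin V W" "c \<in> W" and X: "vector_field_on V A W X"
  shows "X c (\<lambda>p. X p f) = frechet_derivative (\<lambda>x. frechet_derivative (\<lambda>x. f (chart_inv x)) (at x)
    (tcoords (X c))) (at (\<phi> c)) (tcoords (X c))"
proof -
  let ?F = "\<lambda>x. f (chart_inv x)"
  let ?D = "\<lambda>b x. frechet_derivative ?F (at x) b"
  let ?w = "tcoords (X c)"
  have F: "smooth_on (\<phi> ` U) ?F"
    using smooth_fun_on_chart[OF chart_props(1) f[OF chart_props(1)]] by simp
  have Xt: "X p \<in> tangent_space V A p" if "p \<in> W" for p
    using X that by (simp add: vector_field_on_def)
  have Xs: "smooth_fun_on V A S (\<lambda>p. X p g)" if "openin V S" "S \<subseteq> W" "smooth_fun_on V A S g" for S g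
    using X that by (simp add: vector_field_on_def)
  have nf: "smooth_fun_near V A p f" if "p \<in> U" for p
    unfolding smooth_fun_near_def using f chart_props(1) that by blast
  have WU: "openin V (W \<inter> U)" "c \<in> W \<inter> U" using W chart_props(1) c by auto
  have nX: "smooth_fun_near V A c (\<lambda>p. X p (coord b))" for b
    unfolding smooth_fun_near_def using WU Xs[OF WU(1) _ smooth_coord[OF WU(1)]] by blast
  have nD: "smooth_fun_near V A c (\<lambda>p. ?D b (\<phi> p))" for b
    by (rule near_chart_fun[OF c chart_props(2) _ smooth_on_derivative[OF F]]) (use c in auto)
  have nXf: "smooth_fun_near V A c (\<lambda>p. X p f)"
    unfolding smooth_fun_near_def using W Xs[OF W(1) _ f[OF W(1)]] by blast
  have D0: "?D b (\<phi> c) = 0" for b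
    using bspec[OF crit tvec_of_tangent[OF c, of b]] nf[OF c] by (simp add: tvec_of_def)
  have linD: "linear (frechet_derivative ?F (at x))" if "x \<in> \<phi> ` U" for x
    using has_derivative_linear[OF smooth_on_has_derivative[OF F that]] .
  have "X c (\<lambda>p. X p f) = X c (\<lambda>p. \<Sum>b\<in>Basis. X p (coord b) * ?D b (\<phi> p))"
  proof (rule tangent_germ[OF c Xt[OF W(2)] nXf WU])
    fix p assume p: "p \<in> W \<inter> U"
    then have "X p f = frechet_derivative ?F (at (\<phi> p)) (tcoords (X p))"
      using tangent_eq_derivative[OF _ Xt nf] by blast
    also have "\<dots> = (\<Sum>b\<in>Basis. X p (coord b) * ?D b (\<phi> p))"
      using linD[of "\<phi> p"] p by (simp add: tcoords_def linear_sum linear_scale)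
    finally show "X p f = \<dots>" .
  qed
  also have "\<dots> = (\<Sum>b\<in>Basis. X c (\<lambda>p. X p (coord b) * ?D b (\<phi> p)))"
    by (rule tangent_sum[OF c Xt[OF W(2)] near_mult[OF c nX nD]])
  also have "\<dots> = (\<Sum>b\<in>Basis. X c (coord b) * X c (\<lambda>p. ?D b (\<phi> p)))"
    by (simp add: tangent_mult[OF c Xt[OF W(2)] nX nD] D0)
  also have "\<dots> = (\<Sum>b\<in>Basis. X c (coord b) * frechet_derivative (?D b) (at (\<phi> c)) ?w)"
  proof -
    have "X c (\<lambda>p. ?D b (\<phi> p)) = frechet_derivative (?D b) (at (\<phi> c)) ?w" for b
    proof -
      have "(?D b has_derivative frechet_derivative (?D b) (at (\<phi> c))) (at (\<phi> c))"
        using smooth_on_has_derivative[OF smooth_on_derivative[OF F]] c by blast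
      then have "((\<lambda>x. ?D b (\<phi> (chart_inv x))) has_derivative frechet_derivative (?D b) (at (\<phi> c))) (at (\<phi> c))"
        by (rule has_derivative_transform_within_open[OF _ chart_props(2)]) (use c in auto)
      then have "frechet_derivative (\<lambda>x. ?D b (\<phi> (chart_inv x))) (at (\<phi> c)) = frechet_derivative (?D b) (at (\<phi> c))"
        by (rule frechet_derivative_at[symmetric])
      then show ?thesis using tangent_eq_derivative[OF c Xt[OF W(2)] nD] by simp
    qed
    then show ?thesis by simp
  qed
  also have "\<dots> = frechet_derivative (\<lambda>x. frechet_derivative ?F (at x) ?w) (at (\<phi> c)) ?w"
  proof -
    have "((\<lambda>x. \<Sum>b\<in>Basis. X c (coord b) * ?D b x) has_derivative
        (\<lambda>v. \<Sum>b\<in>Basis. X c (coord b) * frechet_derivative (?D b) (at (\<phi> c)) v)) (at (\<phi> c))"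
      using smooth_on_has_derivative[OF smooth_on_derivative[OF F]] c
      by (intro has_derivative_sum has_derivative_mult_right) blast
    then have "((\<lambda>x. frechet_derivative ?F (at x) ?w) has_derivative
        (\<lambda>v. \<Sum>b\<in>Basis. X c (coord b) * frechet_derivative (?D b) (at (\<phi> c)) v)) (at (\<phi> c))"
      by (rule has_derivative_transform_within_open[OF _ chart_props(2)])
        (use c linD in \<open>auto simp: tcoords_def linear_sum linear_scale\<close>)
    from fun_cong[OF frechet_derivative_at[OF this], of ?w] show ?thesis by simp
  qed
  finally show ?thesis .
qed

text \<open>Hence the Hessian is well defined, and in a chart it is half the second derivative.\<close>

lemma hessian_eq:
  assumes f: "\<And>S. openin V S \<Longrightarrow> smooth_fun_on V A S f" and c: "c \<in> U"
    and crit: "\<forall>v\<in>tangent_space V A c. v f = 0" and v: "v \<in> tangent_space V A c"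
  shows "hessian V A f c v = 1/2 * frechet_derivative (\<lambda>x. frechet_derivative (\<lambda>x. f (chart_inv x)) (at x)
    (tcoords v)) (at (\<phi> c)) (tcoords v)"
  unfolding hessian_def
proof (rule the_equality)
  let ?X = "\<lambda>p. tvec_of p (tcoords v)"
  have Xc: "?X c = v" by (rule tvec_of_tcoords[OF c v])
  show "\<exists>W X. openin V W \<and> c \<in> W \<and> vector_field_on V A W X \<and> X c = v \<and>
      1/2 * frechet_derivative (\<lambda>x. frechet_derivative (\<lambda>x. f (chart_inv x)) (at x)
        (tcoords v)) (at (\<phi> c)) (tcoords v) = 1/2 * X c (\<lambda>p. X p f)"
    using second_derivative_field[OF f c crit chart_props(1) c vector_field_tvec_of[of "tcoords v"]]
      chart_props(1) c vector_field_tvec_of Xc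
    by (intro exI[of _ U] exI[of _ ?X]) simp
next
  fix r assume "\<exists>W X. openin V W \<and> c \<in> W \<and> vector_field_on V A W X \<and> X c = v \<and>
    r = 1/2 * X c (\<lambda>p. X p f)"
  then obtain W X where W: "openin V W" "c \<in> W" and X: "vector_field_on V A W X" "X c = v"
    and r: "r = 1/2 * X c (\<lambda>p. X p f)" by blast
  show "r = 1/2 * frechet_derivative (\<lambda>x. frechet_derivative (\<lambda>x. f (chart_inv x)) (at x)
      (tcoords v)) (at (\<phi> c)) (tcoords v)"
    using second_derivative_field[OF f c crit W X(1)] r X(2) by simp
qed

end

section \<open>Linear algebra in the tangent space\<close>

text \<open>The preimage of a box is a finite intersection of sub-basic open sets.\<close>

lemma openin_vs_topology:
  fixes \<theta> :: "'v::real_vector \<Rightarrow> 'e::euclidean_space"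
  assumes "linear \<theta>" and "open O'"
  shows "openin (vs_topology N) {x \<in> N. \<theta> x \<in> O'}"
proof (subst openin_subopen, intro ballI)
  fix x assume "x \<in> {x \<in> N. \<theta> x \<in> O'}"
  then have x: "x \<in> N" "\<theta> x \<in> O'" by auto
  obtain l u where box: "box l u \<subseteq> O'" "\<theta> x \<in> box l u" using open_contains_box[OF assms(2) x(2)] by metis
  let ?H = "\<lambda>b. {y \<in> N. \<theta> y \<bullet> b \<in> {l \<bullet> b <..< u \<bullet> b}}"
  have "openin (vs_topology N) (?H b)" for b
  proof -
    have "linear (\<lambda>y. \<theta> y \<bullet> b)"
      by (intro linearI) (simp_all add: linear_add[OF assms(1)] linear_scale[OF assms(1)] inner_add_left)
    then show ?thesis
      unfolding vs_topology_def by (intro topology_generated_by_Basis CollectI exI[of _ "\<lambda>y. \<theta> y \<bullet> b"]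
          exI[of _ "{l \<bullet> b <..< u \<bullet> b}"] conjI refl open_greaterThanLessThan)
  qed
  then have "openin (vs_topology N) (\<Inter>b\<in>Basis. ?H b)"
    by (intro openin_Inter) (auto simp: nonempty_Basis)
  moreover have "x \<in> (\<Inter>b\<in>Basis. ?H b)" using x box(2) by (auto simp: mem_box)
  moreover have "(\<Inter>b\<in>Basis. ?H b) \<subseteq> {x \<in> N. \<theta> x \<in> O'}"
  proof
    fix y assume y: "y \<in> (\<Inter>b\<in>Basis. ?H b)"
    obtain b :: 'e where "b \<in> Basis" using nonempty_Basis by blast
    then have "y \<in> N" using y by blast
    moreover have "\<theta> y \<in> box l u" using y by (auto simp: mem_box)
    ultimately show "y \<in> {x \<in> N. \<theta> x \<in> O'}" using box(1) by blast
  qed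
  ultimately show "\<exists>T. openin (vs_topology N) T \<and> x \<in> T \<and> T \<subseteq> {x \<in> N. \<theta> x \<in> O'}" by blast
qed

lemma star_shaped_nhd_preimage:
  fixes \<theta> :: "'v::real_vector \<Rightarrow> 'e::euclidean_space"
  assumes "subspace F" and \<theta>: "linear \<theta>" and "open O'" and "convex O'" and "0 \<in> O'"
  shows "star_shaped_nhd F {x \<in> F. \<theta> x \<in> O'}"
  unfolding star_shaped_nhd_def
proof (intro conjI ballI openin_vs_topology assms)
  show "0 \<in> {x \<in> F. \<theta> x \<in> O'}"
    using assms by (simp add: subspace_0 linear_0)
  fix x assume x: "x \<in> {x \<in> F. \<theta> x \<in> O'}"
  show "closed_segment 0 x \<subseteq> {x \<in> F. \<theta> x \<in> O'}"
  proof
    fix y assume "y \<in> closed_segment 0 x"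
    then obtain t where t: "0 \<le> t" "t \<le> 1" "y = t *\<^sub>R x" by (auto simp: closed_segment_def)
    then show "y \<in> {x \<in> F. \<theta> x \<in> O'}"
      using x convexD_alt[OF assms(4,5), of "\<theta> x" t] assms(1)
      by (simp add: linear_scale[OF \<theta>] subspace_scale)
  qed
qed

text \<open>The orthogonal of \<open>D\<close> has codimension at most \<open>dim D\<close>, and it meets \<open>D\<close> only in 0 if
  the form is anisotropic on \<open>D\<close>.\<close>

lemma orthogonal_decomposition_euclidean:
  fixes \<beta> :: "'e::euclidean_space \<Rightarrow> 'e \<Rightarrow> real"
  assumes "bilinear \<beta>" and D: "subspace D" and aniso: "\<And>x. x \<in> D \<Longrightarrow> x \<noteq> 0 \<Longrightarrow> \<beta> x x \<noteq> 0"
  shows "\<exists>y\<in>D. \<forall>z\<in>D. \<beta> (x - y) z = 0"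
proof -
  have lin: "linear (\<lambda>x. \<beta> x y)" "linear (\<beta> x)" for x y
    using assms(1) by (auto simp: bilinear_def)
  \<comment> \<open>The linear map representing the form through the inner product, so that the orthogonal for
    the form is the Euclidean orthogonal of \<open>L ` D\<close>.\<close>
  define L where "L = (\<lambda>y. \<Sum>b\<in>Basis. \<beta> b y *\<^sub>R b)"
  have L: "linear L"
    unfolding L_def using lin(2)
    by (intro linearI) (simp_all add: linear_add linear_scale scaleR_add_left sum.distrib scaleR_sum_right)
  have \<beta>: "\<beta> x y = L y \<bullet> x" for x y
    using linear_basis_expansion[OF lin(1), of x y] by (simp add: L_def inner_sum_right inner_commute[of _ x] mult.commute)
  define D' where "D' = {x \<in> UNIV. \<forall>z\<in>L ` D. orthogonal z x}"
  have D'_iff: "x \<in> D' \<longleftrightarrow> (\<forall>z\<in>D. \<beta> x z = 0)" for x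
    by (auto simp: D'_def orthogonal_def \<beta>)
  have sD': "subspace D'"
    by (rule subspaceI)
      (auto simp: D'_iff linear_0[OF lin(1)] linear_add[OF lin(1)] linear_scale[OF lin(1)])
  have "dim D' + dim (L ` D) = DIM('e)"
    unfolding D'_def
    using dim_subspace_orthogonal_to_vectors[OF linear_subspace_image[OF L D] subspace_UNIV] by simp
  moreover have "dim (L ` D) \<le> dim D" by (rule dim_image_le[OF L])
  moreover have "D \<inter> D' = {0}"
  proof -
    have "x = 0" if "x \<in> D" "x \<in> D'" for x using aniso[of x] that by (auto simp: D'_iff)
    then show ?thesis using subspace_0[OF D] subspace_0[OF sD'] by auto
  qed
  then have "dim {x + y |x y. x \<in> D \<and> y \<in> D'} = dim D + dim D'"
    using dim_sums_Int[OF D sD'] by simp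
  ultimately have "dim {x + y |x y. x \<in> D \<and> y \<in> D'} \<ge> DIM('e)" by linarith
  then have "span {x + y |x y. x \<in> D \<and> y \<in> D'} = UNIV"
    using dim_eq_full dim_subset_UNIV le_antisym by blast
  then have "{x + y |x y. x \<in> D \<and> y \<in> D'} = UNIV"
    using subspace_sums[OF D sD'] by (simp add: span_eq_iff[THEN iffD2])
  then obtain y z where "x = y + z" "y \<in> D" "z \<in> D'" by blast
  then show ?thesis by (intro bexI[of _ y]) (auto simp: D'_iff)
qed

lemma bilinear_assoc_coeff_form: "bilinear (assoc_bilinear (coeff_form a))"
  unfolding bilinear_def
  by (auto intro!: linearI simp: assoc_bilinear_coeff_form linear_add[OF linear_coords]
      linear_scale[OF linear_coords] matrix_vector_right_distrib matrix_vector_mult_scaleR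
      inner_add_left inner_add_right algebra_simps)

lemma orthogonal_decomposition:
  fixes E D :: "'v::real_vector set" and \<theta> :: "'v \<Rightarrow> 'e::euclidean_space"
  assumes E: "subspace E" and \<theta>: "linear \<theta>" "bij_betw \<theta> E UNIV"
    and q: "\<And>v. v \<in> E \<Longrightarrow> q v = coeff_form a (\<theta> v)"
    and D: "subspace D" "D \<subseteq> E" and aniso: "\<And>x. x \<in> D \<Longrightarrow> x \<noteq> 0 \<Longrightarrow> q x \<noteq> 0"
  defines "D' \<equiv> orthogonal_in (assoc_bilinear q) E D"
  shows "subspace D'" and "D \<inter> D' = {0}" and "D + D' = E"
proof -
  let ?\<beta> = "assoc_bilinear (coeff_form a)"
  have b: "assoc_bilinear q v w = ?\<beta> (\<theta> v) (\<theta> w)" if "v \<in> E" "w \<in> E" for v w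
    using that subspace_add[OF E that] by (simp add: assoc_bilinear_def q linear_add[OF \<theta>(1)])
  have lin: "linear (\<lambda>x. ?\<beta> x y)" for y using bilinear_assoc_coeff_form by (auto simp: bilinear_def)
  have D': "v \<in> D' \<longleftrightarrow> v \<in> E \<and> (\<forall>w\<in>D. ?\<beta> (\<theta> v) (\<theta> w) = 0)" for v
    using D(2) b by (auto simp: D'_def orthogonal_in_def subset_iff)
  show sD': "subspace D'"
    using E
    by (intro subspaceI) (auto simp: D' subspace_0 subspace_add subspace_scale linear_0[OF \<theta>(1)] linear_add[OF \<theta>(1)]
        linear_scale[OF \<theta>(1)] linear_0[OF lin] linear_add[OF lin] linear_scale[OF lin])
  have diag: "?\<beta> x x = 2 * coeff_form a x" for x
    by (simp add: assoc_bilinear_coeff_form coeff_form_eq_matrix)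
  have an: "?\<beta> (\<theta> x) (\<theta> x) \<noteq> 0" if "x \<in> D" "x \<noteq> 0" for x
    using aniso[OF that] q[of x] D(2) that by (auto simp: diag)
  show "D \<inter> D' = {0}"
  proof -
    have "x = 0" if "x \<in> D" "x \<in> D'" for x using an[of x] that by (auto simp: D')
    then show ?thesis using subspace_0[OF D(1)] subspace_0[OF sD'] by auto
  qed
  show "D + D' = E"
  proof
    show "D + D' \<subseteq> E" using D(2) D' subspace_add[OF E] by (auto simp: set_plus_def)
    show "E \<subseteq> D + D'"
    proof
      fix e assume e: "e \<in> E"
      have "\<exists>y\<in>\<theta> ` D. \<forall>z\<in>\<theta> ` D. ?\<beta> (\<theta> e - y) z = 0"
      proof (rule orthogonal_decomposition_euclidean[OF bilinear_assoc_coeff_form])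
        show "subspace (\<theta> ` D)" by (rule linear_subspace_image[OF \<theta>(1) D(1)])
        show "?\<beta> x x \<noteq> 0" if "x \<in> \<theta> ` D" "x \<noteq> 0" for x
          using an that linear_0[OF \<theta>(1)] by (metis imageE)
      qed
      then obtain d where d: "d \<in> D" "\<forall>w\<in>D. ?\<beta> (\<theta> e - \<theta> d) (\<theta> w) = 0" by blast
      then have "e - d \<in> D'"
        using e D(2) subspace_diff[OF E e] by (auto simp: D' linear_diff[OF \<theta>(1)])
      then show "e \<in> D + D'" using d(1) by (metis add_diff_cancel_left' diff_add_cancel set_plus_intro add.commute)
    qed
  qed
qed

text \<open>The projection onto \<open>N\<close> along \<open>P\<close>.\<close>

lemma direct_sum_projection:
  fixes N P :: "'e::real_vector set"
  assumes N: "subspace N" and P: "subspace P" and "N \<inter> P = {0}" and "N + P = UNIV"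
  obtains \<pi> where "linear \<pi>" and "\<And>w. \<pi> w \<in> N" and "\<And>w. w - \<pi> w \<in> P"
    and "\<And>x y. x \<in> N \<Longrightarrow> y \<in> P \<Longrightarrow> \<pi> (x + y) = x"
proof -
  have "\<exists>x. x \<in> N \<and> w - x \<in> P" for w
  proof -
    have "w \<in> N + P" using assms(4) by simp
    then obtain x y where "w = x + y" "x \<in> N" "y \<in> P" by (auto elim: set_plus_elim)
    then show ?thesis by (intro exI[of _ x]) simp
  qed
  then obtain \<pi> where \<pi>: "\<And>w. \<pi> w \<in> N" "\<And>w. w - \<pi> w \<in> P" by metis
  have uniq: "\<pi> w = x" if "x \<in> N" "w - x \<in> P" for w x
  proof -
    have "\<pi> w - x \<in> N" using subspace_diff[OF N \<pi>(1) that(1)] .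
    moreover have "(w - x) - (w - \<pi> w) \<in> P" using subspace_diff[OF P that(2) \<pi>(2)] .
    then have "\<pi> w - x \<in> P" by simp
    ultimately have "\<pi> w - x \<in> N \<inter> P" by blast
    then show ?thesis unfolding assms(3) by simp
  qed
  have "linear \<pi>"
  proof (rule linearI)
    show "\<pi> (v + w) = \<pi> v + \<pi> w" for v w
      using subspace_add[OF P \<pi>(2)[of v] \<pi>(2)[of w]]
      by (intro uniq subspace_add[OF N] \<pi>(1)) (simp add: algebra_simps)
    show "\<pi> (r *\<^sub>R v) = r *\<^sub>R \<pi> v" for r v
      using subspace_scale[OF P \<pi>(2)[of v], of r]
      by (intro uniq subspace_scale[OF N] \<pi>(1)) (simp add: scaleR_diff_right)
  qed
  then show thesis using that \<pi> uniq by simp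
qed

text \<open>Inside any neighbourhood of 0, a neighbourhood that is the sum of star-shaped ones.\<close>

lemma star_shaped_sum_nhd:
  fixes E N P :: "'v::real_vector set" and \<theta> :: "'v \<Rightarrow> 'e::euclidean_space"
  assumes E: "subspace E" and \<theta>: "linear \<theta>" "bij_betw \<theta> E UNIV"
    and N: "subspace N" and P: "subspace P" and NP: "N \<inter> P = {0}" "N + P = E"
    and W: "open W" "0 \<in> W"
  obtains U\<^sub>N U\<^sub>P O' where "open O'" and "0 \<in> O'" and "O' \<subseteq> W"
    and "star_shaped_nhd N U\<^sub>N" and "star_shaped_nhd P U\<^sub>P" and "star_shaped_nhd E {v \<in> E. \<theta> v \<in> O'}"
    and "{v \<in> E. \<theta> v \<in> O'} = U\<^sub>N + U\<^sub>P"
proof -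
  have sub: "N \<subseteq> E" "P \<subseteq> E"
    using set_plus_intro[of _ N 0 P] set_plus_intro[of 0 N _ P] subspace_0[OF N] subspace_0[OF P] NP(2)
    by force+
  have inj: "inj_on \<theta> E" and surj: "\<theta> ` E = UNIV" using \<theta>(2) by (auto simp: bij_betw_def)
  have 1: "subspace (\<theta> ` N)" "subspace (\<theta> ` P)"
    by (rule linear_subspace_image[OF \<theta>(1) N] linear_subspace_image[OF \<theta>(1) P])+
  have 2: "\<theta> ` N \<inter> \<theta> ` P = {0}"
    using inj_on_image_Int[OF inj sub] NP(1) by (simp add: linear_0[OF \<theta>(1)])
  have 3: "\<theta> ` N + \<theta> ` P = UNIV"
  proof -
    have "w \<in> \<theta> ` N + \<theta> ` P" for w
    proof -
      obtain e where "e \<in> N + P" "w = \<theta> e" using surj NP(2) by blast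
      then show ?thesis by (auto elim!: set_plus_elim simp: linear_add[OF \<theta>(1)] intro!: set_plus_intro imageI)
    qed
    then show ?thesis by blast
  qed
  obtain \<pi> where \<pi>: "linear \<pi>" "\<And>w. \<pi> w \<in> \<theta> ` N" "\<And>w. w - \<pi> w \<in> \<theta> ` P"
    and \<pi>_sum: "\<And>x y. x \<in> \<theta> ` N \<Longrightarrow> y \<in> \<theta> ` P \<Longrightarrow> \<pi> (x + y) = x"
    using direct_sum_projection[OF 1 2 3] by blast
  obtain r where r: "r > 0" "ball 0 (2 * r) \<subseteq> W"
  proof -
    obtain e where e: "e > 0" "ball 0 e \<subseteq> W" using W open_contains_ball by blast
    then show thesis using that[of "e / 2"] by simp
  qed
  define O' where "O' = \<pi> -` ball 0 r \<inter> (\<lambda>w. w - \<pi> w) -` ball 0 r"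
  have \<pi>': "linear (\<lambda>w. w - \<pi> w)" using \<pi>(1) by (intro linear_compose_sub linear_ident)
  have "open (L -` ball 0 r)" if "linear L" for L :: "'e \<Rightarrow> 'e"
    using continuous_open_preimage[OF linear_continuous_on[OF linear_conv_bounded_linear[THEN iffD1, OF that]] open_UNIV open_ball]
    by simp
  then have oO: "open O'" using \<pi>(1) \<pi>' by (simp add: O'_def open_Int)
  have cO: "convex O'"
    unfolding O'_def using \<pi>(1) \<pi>' by (intro convex_Int convex_linear_vimage convex_ball)
  have zO: "0 \<in> O'" using r(1) by (simp add: O'_def linear_0[OF \<pi>(1)])
  have OW: "O' \<subseteq> W"
  proof
    fix w assume "w \<in> O'"
    then have "norm (\<pi> w) < r" "norm (w - \<pi> w) < r" by (auto simp: O'_def)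
    then have "norm w < 2 * r" using norm_triangle_ineq[of "\<pi> w" "w - \<pi> w"] by simp
    then show "w \<in> W" using r(2) by auto
  qed
  let ?UN = "{x \<in> N. \<theta> x \<in> ball 0 r}" and ?UP = "{x \<in> P. \<theta> x \<in> ball 0 r}"
  have "{v \<in> E. \<theta> v \<in> O'} = ?UN + ?UP"
  proof
    show "{v \<in> E. \<theta> v \<in> O'} \<subseteq> ?UN + ?UP"
    proof
      fix v assume v: "v \<in> {v \<in> E. \<theta> v \<in> O'}"
      then obtain x y where xy: "v = x + y" "x \<in> N" "y \<in> P" using NP(2) by (auto elim: set_plus_elim)
      then have "\<pi> (\<theta> v) = \<theta> x" by (simp add: linear_add[OF \<theta>(1)] \<pi>_sum)
      then have "\<theta> x \<in> ball 0 r" "\<theta> y \<in> ball 0 r"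
        using v xy by (auto simp: O'_def linear_add[OF \<theta>(1)])
      then show "v \<in> ?UN + ?UP" using xy by (auto intro: set_plus_intro)
    qed
    show "?UN + ?UP \<subseteq> {v \<in> E. \<theta> v \<in> O'}"
    proof
      fix v assume "v \<in> ?UN + ?UP"
      then obtain x y where xy: "v = x + y" "x \<in> N" "y \<in> P" "\<theta> x \<in> ball 0 r" "\<theta> y \<in> ball 0 r"
        by (auto elim!: set_plus_elim)
      then have "\<pi> (\<theta> v) = \<theta> x" by (simp add: linear_add[OF \<theta>(1)] \<pi>_sum)
      then show "v \<in> {v \<in> E. \<theta> v \<in> O'}"
        using xy sub subspace_add[OF E] by (auto simp: O'_def linear_add[OF \<theta>(1)])
    qed
  qed
  moreover have "star_shaped_nhd N ?UN" "star_shaped_nhd P ?UP"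
    using r(1) by (intro star_shaped_nhd_preimage N P \<theta>(1) open_ball convex_ball, simp)+
  ultimately show thesis
    using that oO zO OW star_shaped_nhd_preimage[OF E \<theta>(1) oO cO zO] by blast
qed

section \<open>The Morse lemma on manifolds\<close>

theorem mainTheorem4:
  fixes V :: "'a topology" and A :: "('a, 'e::euclidean_space) atlas"
    and f :: "'a \<Rightarrow> real" and c :: 'a
    and E N P :: "'a tvec set" and q :: "'a tvec \<Rightarrow> real" and b :: "'a tvec \<Rightarrow> 'a tvec \<Rightarrow> real"
  assumes "smooth_manifold V A"
    and "smooth_fun_on V A (topspace V) f"
    and "nondegenerate_critical_point V A f c"
    and "E = tangent_space V A c"
    and "q = hessian V A f c"
    and "b = assoc_bilinear q"
    and "(maximal_subspace (neg_def_on q) E N \<and> P = orthogonal_in b E N) \<or>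
         (maximal_subspace (pos_def_on q) E P \<and> N = orthogonal_in b E P)"
  shows "subspace N \<and> subspace P \<and> N \<inter> P = {0} \<and> N + P = E \<and>
    (\<exists>U\<^sub>N U\<^sub>P U \<U> \<psi>.
       star_shaped_nhd N U\<^sub>N \<and> star_shaped_nhd P U\<^sub>P \<and> star_shaped_nhd E U \<and> U = U\<^sub>N + U\<^sub>P \<and>
       diffeomorphism (vs_topology E) (tangent_atlas V A c) U V A \<U> \<psi> \<and>
       c \<in> \<U> \<and> \<psi> 0 = c \<and>
       (\<forall>v\<in>E. tangent_map V A \<psi> 0 (tangent_identification V A c v) = v) \<and>
       (\<forall>u\<in>U. f (\<psi> u) - f c = q u) \<and>
       (\<forall>x\<in>N. \<forall>y\<in>P. x + y \<in> U \<longrightarrow> q (x + y) = q x + q y))"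
proof -
  have atlas: "smooth_atlas V A" using assms(1) by (simp add: smooth_manifold_def)
  have crit: "critical_point V A f c"
    and bij_b: "bij_betw (\<lambda>v. restrict (b v) E) E (dual_space E)"
    using assms(3) by (simp_all add: nondegenerate_critical_point_def assms(4-6))
  have c: "c \<in> topspace V" and crit: "\<forall>v\<in>tangent_space V A c. v f = 0"
    using crit by (auto simp: critical_point_def)
  obtain Uc \<phi> where Uc: "(Uc, \<phi>) \<in> A" "c \<in> Uc"
    using atlas c unfolding smooth_atlas_def by fast
  interpret chart_of_atlas V A Uc \<phi> using atlas Uc(1) by unfold_locales
  let ?\<theta> = "tcoords" and ?F = "\<lambda>x. f (chart_inv x)" and ?x0 = "\<phi> c"
  have f: "smooth_fun_on V A S f" if "openin V S" for S
    using smooth_map_on_subset[OF assms(2) that openin_subset[OF that]] .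
  note \<theta> = linear_tcoords bij_tcoords[OF Uc(2), folded assms(4)]
  have E: "subspace E" using subspace_tangent_space[OF Uc(2)] by (simp add: assms(4))
  have F: "smooth_on (\<phi> ` Uc) ?F"
    using smooth_fun_on_chart[OF chart_props(1) f[OF chart_props(1)]] by simp
  have nf: "smooth_fun_near V A c f"
    unfolding smooth_fun_near_def using f chart_props(1) Uc(2) by blast
  obtain r where r: "r > 0" "ball ?x0 r \<subseteq> \<phi> ` Uc"
    using chart_props(2) Uc(2) open_contains_ball by (metis imageI)
  let ?B = "ball ?x0 r"
  have x0B: "?x0 \<in> ?B" using r(1) by simp
  \<comment> \<open>The vectors \<open>tvec_of c w\<close> annihilate \<open>f\<close>.\<close>
  have DF0: "frechet_derivative ?F (at ?x0) w = 0" for w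
    using bspec[OF crit tvec_of_tangent[OF Uc(2), of w]] nf by (simp add: tvec_of_def)
  obtain h where h: "\<And>b b'. smooth_on ?B (h b b')"
    and Fh: "\<And>x. x \<in> ?B \<Longrightarrow> ?F x = ?F ?x0 + coeff_form (\<lambda>b b'. h b b' x) (x - ?x0)"
    and Hh: "\<And>w. frechet_derivative (\<lambda>x. frechet_derivative ?F (at x) w) (at ?x0) w =
      2 * coeff_form (\<lambda>b b'. h b b' ?x0) w"
    by (rule hadamard_critical[OF open_ball convex_ball x0B smooth_on_subset[OF F r(2)] DF0]) blast
  let ?Q = "coeff_form (\<lambda>b b'. h b b' ?x0)"
  have q: "q v = ?Q (?\<theta> v)" if "v \<in> E" for v
    using hessian_eq[OF f Uc(2) crit that[unfolded assms(4)]] by (simp add: assms(5) Hh)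
  have b: "b v w = assoc_bilinear ?Q (?\<theta> v) (?\<theta> w)" if "v \<in> E" "w \<in> E" for v w
    using that subspace_add[OF E that] by (simp add: assms(6) assoc_bilinear_def q linear_add[OF \<theta>(1)])
  have nondeg: "w = 0" if w: "\<And>w'. assoc_bilinear ?Q w w' = 0" for w
  proof -
    have "v = 0" if v: "v \<in> E" "?\<theta> v = w" for v
    proof -
      have "assoc_bilinear ?Q 0 z = 0" for z
        by (simp add: assoc_bilinear_def coeff_form_def)
      then have "restrict (b v) E = restrict (b 0) E"
        using b v w subspace_0[OF E] by (auto simp: restrict_def fun_eq_iff linear_0[OF \<theta>(1)])
      then show ?thesis
        using bij_betw_imp_inj_on[OF bij_b] v(1) subspace_0[OF E] by (auto dest: inj_onD)
    qed
    moreover obtain v where "v \<in> E" "?\<theta> v = w" using \<theta>(2) by (metis bij_betw_imp_surj_on UNIV_I imageE)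
    ultimately show ?thesis using linear_0[OF \<theta>(1)] by metis
  qed
  have decomp: "subspace D \<Longrightarrow> D \<subseteq> E \<Longrightarrow> (\<And>x. x \<in> D \<Longrightarrow> x \<noteq> 0 \<Longrightarrow> q x \<noteq> 0) \<Longrightarrow>
      subspace (orthogonal_in b E D) \<and> D \<inter> orthogonal_in b E D = {0} \<and> D + orthogonal_in b E D = E" for D
    using orthogonal_decomposition[OF E \<theta> q] by (simp add: assms(6))
  have NP: "subspace N \<and> subspace P \<and> N \<inter> P = {0} \<and> N + P = E \<and> (\<forall>x\<in>N. \<forall>y\<in>P. q (x + y) = q x + q y)"
    using assms(7)
  proof
    assume N: "maximal_subspace (neg_def_on q) E N \<and> P = orthogonal_in b E N"
    then have D: "subspace N" "N \<subseteq> E" "\<And>x. x \<in> N \<Longrightarrow> x \<noteq> 0 \<Longrightarrow> q x \<noteq> 0"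
      by (force simp: maximal_subspace_def neg_def_on_def)+
    have "q (x + y) = q x + q y" if "x \<in> N" "y \<in> P" for x y
    proof -
      have "b y x = 0" using N that by (auto simp: orthogonal_in_def)
      then show ?thesis by (simp add: assms(6) assoc_bilinear_def add.commute)
    qed
    then show ?thesis using decomp[OF D(1,2) D(3)] D(1) N by simp
  next
    assume P: "maximal_subspace (pos_def_on q) E P \<and> N = orthogonal_in b E P"
    then have D: "subspace P" "P \<subseteq> E" "\<And>x. x \<in> P \<Longrightarrow> x \<noteq> 0 \<Longrightarrow> q x \<noteq> 0"
      by (force simp: maximal_subspace_def pos_def_on_def)+
    have "q (x + y) = q x + q y" if "x \<in> N" "y \<in> P" for x y
    proof -
      have "b x y = 0" using P that by (auto simp: orthogonal_in_def)
      then show ?thesis by (simp add: assms(6) assoc_bilinear_def)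
    qed
    then show ?thesis using decomp[OF D(1,2) D(3)] D(1) P by (simp add: Int_commute add.commute)
  qed
  obtain W T \<psi>' \<Phi> where WT: "open W" "open T" "0 \<in> W" "T \<subseteq> ?B"
    and maps: "\<psi>' ` W \<subseteq> T" "\<Phi> ` T \<subseteq> W" "\<And>y. y \<in> W \<Longrightarrow> \<Phi> (\<psi>' y) = y" "\<And>x. x \<in> T \<Longrightarrow> \<psi>' (\<Phi> x) = x"
    and sm: "smooth_on W \<psi>'" "smooth_on T \<Phi>"
    and \<psi>0: "\<psi>' 0 = ?x0" "(\<psi>' has_derivative (\<lambda>v. v)) (at 0)"
    and Morse: "\<And>y. y \<in> W \<Longrightarrow> ?F (\<psi>' y) = ?F ?x0 + ?Q y"
    by (rule morse_lemma_euclidean[OF open_ball x0B h Fh nondeg]) blast+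
  have sum: "subspace N" "subspace P" "N \<inter> P = {0}" "N + P = E" using NP by simp_all
  obtain U\<^sub>N U\<^sub>P O' where O': "open O'" "0 \<in> O'" "O' \<subseteq> W"
    and star: "star_shaped_nhd N U\<^sub>N" "star_shaped_nhd P U\<^sub>P" "star_shaped_nhd E {v \<in> E. ?\<theta> v \<in> O'}"
    and U_sum: "{v \<in> E. ?\<theta> v \<in> O'} = U\<^sub>N + U\<^sub>P"
    by (rule star_shaped_sum_nhd[OF E \<theta> sum(1-4) WT(1,3)]) blast
  \<comment> \<open>The Euclidean solution is conjugated by the linear chart \<open>tcoords\<close> of \<open>E\<close> and the chart
    \<open>\<phi>\<close>, and restricted to \<open>O'\<close>, whose image is \<open>T'\<close>.\<close>
  define U where "U = {v \<in> E. ?\<theta> v \<in> O'}"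
  define \<psi> where "\<psi> = (\<lambda>v. chart_inv (\<psi>' (?\<theta> v)))"
  define T' where "T' = T \<inter> \<Phi> -` O'"
  have TU: "T \<subseteq> \<phi> ` Uc" using WT(4) r(2) by blast
  have T': "open T'"
    unfolding T'_def by (rule continuous_open_preimage[OF smooth_on_continuous[OF sm(2)] WT(2) O'(1)])
  have T'U: "T' \<subseteq> \<phi> ` Uc" using TU by (auto simp: T'_def)
  have \<psi>'T': "\<psi>' y \<in> T'" if "y \<in> O'" for y
    using that maps(1,3) O'(3) by (force simp: T'_def)
  have \<Phi>O: "\<Phi> x \<in> O'" "\<psi>' (\<Phi> x) = x" if "x \<in> T'" for x
    using that maps(4) by (auto simp: T'_def)
  have \<Phi>\<psi>: "\<Phi> (\<psi>' y) = y" if "y \<in> O'" for y using that maps(3) O'(3) by blast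
  let ?\<tau> = "tvec_of c"
  have \<tau>E: "?\<tau> w \<in> E" and \<theta>\<tau>: "?\<theta> (?\<tau> w) = w" for w
    using tvec_of_tangent[OF Uc(2)] tcoords_tvec_of[OF Uc(2)] by (simp_all add: assms(4))
  have \<tau>\<theta>: "?\<tau> (?\<theta> v) = v" if "v \<in> E" for v
    using tvec_of_tcoords[OF Uc(2)] that by (simp add: assms(4))
  have invE: "inv_into E ?\<theta> w = ?\<tau> w" for w
    by (rule inv_into_f_eq[OF bij_betw_imp_inj_on[OF \<theta>(2)]]) (rule \<tau>E, rule \<theta>\<tau>)
  have \<theta>_atlas: "(E, ?\<theta>) \<in> tangent_atlas V A c"
    using \<theta> by (auto simp: tangent_atlas_def assms(4))
  have \<theta>_image: "?\<theta> ` {v \<in> E. ?\<theta> v \<in> X} = X" for X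
    using \<tau>E \<theta>\<tau> by (force simp: image_iff)
  let ?U' = "chart_inv ` T'"
  have \<phi>\<U>: "\<phi> ` ?U' = T'" "?U' \<subseteq> Uc" using T'U by (force simp: image_iff)+
  have inv\<psi>: "chart_inv x \<in> ?U' \<and> ?\<tau> (\<Phi> x) \<in> U \<and> \<psi> (?\<tau> (\<Phi> x)) = chart_inv x" if "x \<in> T'" for x
    using that \<Phi>O \<tau>E \<theta>\<tau> by (auto simp: U_def \<psi>_def)
  have inj: "inj_on \<psi> U"
  proof (rule inj_on_inverseI)
    fix v assume "v \<in> U"
    then have v: "v \<in> E" "?\<theta> v \<in> O'" by (auto simp: U_def)
    have "\<psi>' (?\<theta> v) \<in> \<phi> ` Uc" using \<psi>'T'[OF v(2)] T'U by blast
    then show "?\<tau> (\<Phi> (\<phi> (\<psi> v))) = v"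
      using v by (simp add: \<psi>_def \<Phi>\<psi> \<tau>\<theta>)
  qed
  have img: "\<psi> ` U = ?U'"
  proof
    show "\<psi> ` U \<subseteq> ?U'" using \<psi>'T' by (auto simp: U_def \<psi>_def)
    show "?U' \<subseteq> \<psi> ` U" using inv\<psi> by (metis image_eqI image_subsetI)
  qed
  have inv_into_\<psi>: "inv_into U \<psi> (chart_inv x) = ?\<tau> (\<Phi> x)" if "x \<in> T'" for x
    using inv_into_f_eq[OF inj] inv\<psi>[OF that] by blast
  have openU: "openin (vs_topology E) U"
    unfolding U_def by (rule openin_vs_topology[OF \<theta>(1) O'(1)])
  have forward: "smooth_map_on (vs_topology E) (tangent_atlas V A c) A U \<psi>"
    unfolding smooth_map_on_def
  proof (intro ballI exI conjI)
    show "smooth_on (?\<theta> ` U) (\<phi> \<circ> \<psi> \<circ> inv_into E ?\<theta>)"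
      unfolding U_def \<theta>_image
    proof (rule smooth_on_cong[OF O'(1) _ smooth_on_subset[OF sm(1) O'(3)]])
      fix y assume "y \<in> O'"
      then have "\<psi>' y \<in> \<phi> ` Uc" using \<psi>'T' T'U by blast
      then show "\<psi>' y = (\<phi> \<circ> \<psi> \<circ> inv_into E ?\<theta>) y" by (simp add: invE \<psi>_def \<theta>\<tau>)
    qed
    show "\<psi> ` U \<subseteq> Uc" using img \<phi>\<U>(2) by simp
  qed (use \<theta>_atlas Uc openU in \<open>auto simp: U_def\<close>)
  have openU': "openin V ?U'" by (rule openin_chart_inv[OF T' T'U])
  have backward: "smooth_map_on V A (tangent_atlas V A c) ?U' (inv_into U \<psi>)"
    unfolding smooth_map_on_def
  proof (intro ballI exI conjI)
    show "smooth_on (\<phi> ` ?U') (?\<theta> \<circ> inv_into U \<psi> \<circ> inv_into Uc \<phi>)"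
      unfolding \<phi>\<U>(1)
    proof (rule smooth_on_cong[OF T' _ smooth_on_subset[OF sm(2)]])
      show "\<Phi> x = (?\<theta> \<circ> inv_into U \<psi> \<circ> inv_into Uc \<phi>) x" if "x \<in> T'" for x
        using inv_into_\<psi>[OF that] by (simp add: chart_inv_def[symmetric] \<theta>\<tau>)
    qed (auto simp: T'_def)
    show "inv_into U \<psi> ` ?U' \<subseteq> E" using inv_into_\<psi> \<tau>E by auto
  qed (use \<theta>_atlas Uc(1) openU' \<phi>\<U>(2) in auto)
  have diffeo: "diffeomorphism (vs_topology E) (tangent_atlas V A c) U V A ?U' \<psi>"
    using openU openU' inj img forward backward by (simp add: diffeomorphism_def bij_betw_def)
  have \<theta>0: "?\<theta> 0 = 0" by (rule linear_0[OF \<theta>(1)])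
  have \<psi>c: "\<psi> 0 = c" using Uc(2) by (simp add: \<psi>_def \<theta>0 \<psi>0)
  have cU': "c \<in> ?U'"
  proof -
    have "0 \<in> U" using O'(2) subspace_0[OF E] by (simp add: U_def \<theta>0)
    then show ?thesis using img \<psi>c by blast
  qed
  have tangent: "tangent_map V A \<psi> 0 (tangent_identification V A c v) = v" if v: "v \<in> E" for v
  proof
    fix g
    have vT: "v \<in> tangent_space V A c" using v by (simp add: assms(4))
    show "tangent_map V A \<psi> 0 (tangent_identification V A c v) g = v g"
    proof (cases "smooth_fun_near V A c g")
      case False
      then show ?thesis using tangent_nonsmooth[OF Uc(2) vT] by (simp add: tangent_map_def \<psi>c)
    next
      case True
      let ?G = "\<lambda>x. g (chart_inv x)"
      obtain Z where Z: "open Z" "?x0 \<in> Z" "Z \<subseteq> \<phi> ` Uc" "smooth_on Z ?G"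
        using near_cases[OF Uc(2) True] .
      \<comment> \<open>The identification is 0 on functions that are not smooth near 0, so smoothness of \<open>g \<circ> \<psi>\<close> is needed.\<close>
      define Y where "Y = W \<inter> \<psi>' -` Z"
      have Y: "open Y" "0 \<in> Y"
        using continuous_open_preimage[OF smooth_on_continuous[OF sm(1)] WT(1) Z(1)] WT(3) Z(2)
        by (simp_all add: Y_def \<psi>0(1))
      have smY: "smooth_on Y (\<lambda>y. ?G (\<psi>' y))"
        by (rule smooth_on_compose[OF Y(1) Z(1) smooth_on_subset[OF sm(1)] Z(4)]) (auto simp: Y_def)
      have "smooth_fun_on (vs_topology E) (tangent_atlas V A c) {v \<in> E. ?\<theta> v \<in> Y} (g \<circ> \<psi>)"
        unfolding smooth_map_on_def
      proof (intro ballI exI conjI)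
        show "smooth_on (?\<theta> ` {v \<in> E. ?\<theta> v \<in> Y}) (id \<circ> (g \<circ> \<psi>) \<circ> inv_into E ?\<theta>)"
          unfolding \<theta>_image using smY by (simp add: comp_def invE \<psi>_def \<theta>\<tau>)
      qed (use \<theta>_atlas openin_vs_topology[OF \<theta>(1) Y(1)] in auto)
      then have near: "smooth_fun_near (vs_topology (tangent_space V A c)) (tangent_atlas V A c) 0 (g \<circ> \<psi>)"
        unfolding smooth_fun_near_def assms(4)[symmetric]
        using openin_vs_topology[OF \<theta>(1) Y(1)] Y(2) subspace_0[OF E] \<theta>0
        by (intro exI[of _ "{v \<in> E. ?\<theta> v \<in> Y}"]) simp
      \<comment> \<open>Chain rule along the ray of \<open>v\<close>: \<open>\<psi>'\<close> has derivative the identity at 0.\<close>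
      have DG: "(?G has_derivative frechet_derivative ?G (at ?x0)) (at ?x0)"
        by (rule near_has_derivative[OF Uc(2) True])
      have "((\<lambda>t. t *\<^sub>R ?\<theta> v) has_derivative (\<lambda>t. t *\<^sub>R ?\<theta> v)) (at 0)"
        by (auto intro!: derivative_eq_intros)
      then have "((\<lambda>t. \<psi>' (t *\<^sub>R ?\<theta> v)) has_derivative (\<lambda>t. t *\<^sub>R ?\<theta> v)) (at 0)"
        by (rule has_derivative_compose) (use \<psi>0(2) in simp)
      then have "((\<lambda>t. ?G (\<psi>' (t *\<^sub>R ?\<theta> v))) has_derivative
          (\<lambda>t. frechet_derivative ?G (at ?x0) (t *\<^sub>R ?\<theta> v))) (at 0)"
        by (rule has_derivative_compose) (use DG \<psi>0(1) in simp)
      moreover have "(\<lambda>t. frechet_derivative ?G (at ?x0) (t *\<^sub>R ?\<theta> v)) =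
          (\<lambda>t. v g * t)"
        using linear_scale[OF has_derivative_linear[OF DG]] tangent_eq_derivative[OF Uc(2) vT True]
        by (simp add: fun_eq_iff)
      ultimately have "((\<lambda>t. ?G (\<psi>' (t *\<^sub>R ?\<theta> v))) has_field_derivative v g) (at 0)"
        by (simp add: has_field_derivative_def)
      then have "deriv (\<lambda>t. (g \<circ> \<psi>) (t *\<^sub>R v)) 0 = v g"
        by (simp add: \<psi>_def linear_scale[OF \<theta>(1)] DERIV_imp_deriv)
      then show ?thesis
        using True near by (simp add: tangent_map_def \<psi>c tangent_identification_def)
    qed
  qed
  have Morse_E: "f (\<psi> u) - f c = q u" if "u \<in> U" for u
  proof -
    have u: "u \<in> E" "?\<theta> u \<in> W" using that O'(3) by (auto simp: U_def)
    then show ?thesis using Morse[OF u(2)] q[OF u(1)] Uc(2) by (simp add: \<psi>_def)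
  qed
  show ?thesis
    using NP star U_sum[folded U_def] diffeo cU' \<psi>c tangent Morse_E unfolding U_def[symmetric]
    by (intro conjI exI[of _ U\<^sub>N] exI[of _ U\<^sub>P] exI[of _ U] exI[of _ ?U'] exI[of _ \<psi>]) auto
qed

end
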